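(* Let $\rho$ be an $\mathrm{SL}(2,\mathbb{C})$ character of the one-holed torus $T$ and let $\mathcal{E}(\rho)\subseteq \mathscr{PL}$ be its set of end invariants. Then $\mathcal{E}(\rho)=\mathscr{PL}$ if and only if (i) $\rho$ is dihedral, or (ii) $\rho$ corresponds to an $\mathrm{SU}(2)$ representation. Furthermore, if $\mathcal{E}(\rho)\neq \mathscr{PL}$, then $\mathcal{E}(\rho)$ has empty interior in $\mathscr{PL}$.
   Context: $T$ is the one-holed torus; $\pi=\pi_1(T)$ is free on two generators $X,Y$. The character variety is $\mathcal{X}=\mathrm{Hom}(\pi,\mathrm{SL}(2,\mathbb{C}))/\!/\mathrm{SL}(2,\mathbb{C})$, identified with $\mathbb{C}^3$ via $\rho\mapsto(x,y,z)=(\mathrm{tr}\,\rho(X),\mathrm{tr}\,\rho(Y),\mathrm{tr}\,\rho(XY))$; an element $\rho$ is called a character. $\mathscr{C}$ denotes the set of free homotopy classes of essential (non-trivial, non-boundary-parallel) simple closed curves on $T$; for $W\in\mathscr{C}$, $\mathrm{tr}\,\rho(W)$ is well defined. $\mathscr{PL}$ is the projective lamination space of $T$, identified with $\hat{\mathbb{R}}=\mathbb{R}\cup\{\infty\}$ so that $\mathscr{C}$ corresponds to $\hat{\mathbb{Q}}$ (with $X,Y,XY$ corresponding to $0,\infty,1$), with the topology of $\hat{\mathbb R}$. An element $\Lambda\in\mathscr{PL}$ is an end invariant of $\rho$ if there exist $K>0$ and a sequence of distinct $X_n\in\mathscr{C}$ with $X_n\to\Lambda$ and $|\mathrm{tr}\,\rho(X_n)|<K$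 for all $n$; $\mathcal{E}(\rho)$ is the set of end invariants. A character is dihedral if two of the entries of its triple $(x,y,z)$ are zero. *)

theory Defs
  imports "HOL-Analysis.Analysis"
begin

definition SL2C :: "(complex^2^2) set" where
  "SL2C = {A. det A = 1}"

definition conj_transpose :: "complex^2^2 \<Rightarrow> complex^2^2" where
  "conj_transpose A = (\<chi> i j. cnj (A $ j $ i))"

definition SU2 :: "(complex^2^2) set" where
  "SU2 = {A. det A = 1 \<and> A ** conj_transpose A = mat 1}"

text \<open>A representation of the free group on X, Y is a pair (A,B) = (rho X, rho Y).
  Its character is the triple (tr A, tr B, tr AB).\<close>
definition character :: "complex^2^2 \<Rightarrow> complex^2^2 \<Rightarrow> complex \<times> complex \<times> complex" where
  "character A B = (trace A, trace B, trace (A ** B))"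

definition dihedral :: "complex \<times> complex \<times> complex \<Rightarrow> bool" where
  "dihedral c = (case c of (x, y, z) \<Rightarrow>
      (x = 0 \<and> y = 0) \<or> (x = 0 \<and> z = 0) \<or> (y = 0 \<and> z = 0))"

definition SU2_character :: "complex \<times> complex \<times> complex \<Rightarrow> bool" where
  "SU2_character c = (\<exists>A\<in>SU2. \<exists>B\<in>SU2. character A B = c)"

datatype letter = LX | LY | LYi

definition letter_mat :: "complex^2^2 \<Rightarrow> complex^2^2 \<Rightarrow> letter \<Rightarrow> complex^2^2" where
  "letter_mat A B l = (case l of LX \<Rightarrow> A | LY \<Rightarrow> B | LYi \<Rightarrow> matrix_inv B)"

definition word_mat :: "complex^2^2 \<Rightarrow> complex^2^2 \<Rightarrow> letter list \<Rightarrow> complex^2^2" where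
  "word_mat A B w = foldr (\<lambda>l M. letter_mat A B l ** M) w (mat 1)"

text \<open>Essential simple closed curves on T, i.e. elements of Q-hat: a curve is encoded by
  a coprime integer pair (p,q), normalised with q > 0, or (p,q) = (1,0), and has slope p/q.
  X = (0,1) (slope 0), Y = (1,0) (slope infinity), XY = (1,1) (slope 1).\<close>
definition curves :: "(int \<times> int) set" where
  "curves = {(p, q). coprime p q \<and> (q > 0 \<or> (q = 0 \<and> p = 1))}"

text \<open>Christoffel word representing the curve of slope p/q: q letters X and |p| letters
  Y (if p \<ge> 0) resp. Y inverse (if p < 0).\<close>
definition curve_word :: "int \<times> int \<Rightarrow> letter list" where
  "curve_word c = (case c of (p, q) \<Rightarrow>
     (let n = nat q + nat \<bar>p\<bar>; a = nat \<bar>p\<bar> in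
      map (\<lambda>i. if (i * a) div n > ((i - 1) * a) div n
                then (if p \<ge> 0 then LY else LYi) else LX) [1..<n+1]))"

definition curve_trace :: "complex^2^2 \<Rightarrow> complex^2^2 \<Rightarrow> int \<times> int \<Rightarrow> complex" where
  "curve_trace A B c = trace (word_mat A B (curve_word c))"

text \<open>The projective lamination space PL = R-hat, realised as the unit circle in C via the
  homeomorphism r \<mapsto> ((1 + i r)/|1 + i r|)^2, infinity \<mapsto> -1.\<close>
definition PL :: "complex set" where
  "PL = sphere 0 1"

definition slope_point :: "int \<times> int \<Rightarrow> complex" where
  "slope_point c = (case c of (p, q) \<Rightarrow>
     (of_int q + \<i> * of_int p)^2 / of_real (real_of_int q ^ 2 + real_of_int p ^ 2))"

definition end_invariants :: "complex^2^2 \<Rightarrow> complex^2^2 \<Rightarrow> complex set" where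
  "end_invariants A B = {\<Lambda> \<in> PL. \<exists>K>0. \<exists>Xs :: nat \<Rightarrow> int \<times> int.
      (\<forall>n. Xs n \<in> curves) \<and> inj Xs \<and>
      (\<lambda>n. slope_point (Xs n)) \<longlonglongrightarrow> \<Lambda> \<and>
      (\<forall>n. norm (curve_trace A B (Xs n)) < K)}"

end

theory Submission
  imports Defs
begin

text \<open>Traces of the simple closed curves form a Markoff map: a function on primitive integer vectors with
  \<open>f (v + w) + f (v - w) = f v * f w\<close> for every basis \<open>(v, w)\<close> of the integer lattice, so that
  \<open>n \<mapsto> f (w + n v)\<close> satisfies a linear recurrence with characteristic roots \<open>l\<close>, \<open>1 / l\<close>,
  \<open>l + 1 / l = f v\<close>. Suppose that an open set consists of end invariants and that the character is not
  dihedral. If some \<open>f v\<close> there were outside \<open>[-2, 2]\<close>, then \<open>f (w + n v)\<close> would grow exponentially in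
  one direction, and a large value surrounded by large values propagates through the whole cone beyond
  it; so all values on the open set lie in \<open>[-2, 2]\<close>. The expression
  \<open>m = x\<^sup>2 + y\<^sup>2 + z\<^sup>2 - x y z\<close> does not depend on the basis. If \<open>m > 4\<close>, then near each vector \<open>v\<close>
  there is one whose value is larger than \<open>\<bar>f v\<bar>\<close> by a factor \<open>sqrt m / 2 > 1\<close>, which cannot go on within
  \<open>[-2, 2]\<close>. Hence \<open>m \<le> 4\<close>; then the bound by 2 passes from one basis to all others, and
  a real triple in \<open>[-2, 2]\<close> with \<open>m \<le> 4\<close> is the character of an SU(2) representation.\<close>

subsection \<open>Christoffel words and traces\<close>

text \<open>Cayley-Hamilton for determinant one: multiply Q^2 - tr(Q) Q + 1 = 0 by \<open>P\<close>
  from the left and take traces.\<close>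

lemma trace_cayley_right:
  fixes P Q :: "complex^2^2"
  assumes "det Q = 1"
  shows "trace (P ** Q ** Q) + trace P = trace (P ** Q) * trace Q"
proof -
  have "trace (P ** Q ** Q) + trace P - trace (P ** Q) * trace Q = (1 - det Q) * trace P"
    unfolding trace_def matrix_matrix_mult_def sum_2 vec_lambda_beta det_2
    by (simp add: algebra_simps)
  then show ?thesis
    using assms by simp
qed

lemma trace_cayley_left:
  fixes P Q :: "complex^2^2"
  assumes "det P = 1"
  shows "trace (P ** (P ** Q)) + trace Q = trace P * trace (P ** Q)"
proof -
  have "trace (P ** (P ** Q)) + trace Q - trace P * trace (P ** Q) = (1 - det P) * trace Q"
    unfolding trace_def matrix_matrix_mult_def sum_2 vec_lambda_beta det_2
    by (simp add: algebra_simps)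
  then show ?thesis
    using assms by simp
qed

lemma matrix_inv_det_1:
  fixes B :: "complex^2^2"
  assumes "det B = 1"
  shows "B ** matrix_inv B = mat 1" "matrix_inv B ** B = mat 1" "det (matrix_inv B) = 1"
proof -
  have i: "invertible B"
    using assms by (simp add: invertible_det_nz)
  show r: "B ** matrix_inv B = mat 1" and "matrix_inv B ** B = mat 1"
    using someI_ex[OF i[unfolded invertible_def], folded matrix_inv_def] by auto
  have "det B * det (matrix_inv B) = 1"
    using r by (metis det_I det_mul)
  then show "det (matrix_inv B) = 1"
    using assms by simp
qed

text \<open>The staircase word of \<open>curve_word\<close> with the letter for the jumps left open,
  so that \<open>LY\<close> and \<open>LYi\<close> serve positive and negative slopes alike;
  \<open>n\<close> is the length of the word, not the number of letters \<open>LX\<close>.\<close>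

definition christoffel :: "letter \<Rightarrow> nat \<Rightarrow> nat \<Rightarrow> letter list" where
  "christoffel L a n = map (\<lambda>i. if (i * a) div n > ((i - 1) * a) div n then L else LX) [1..<n+1]"

lemma nat_div_eqI:
  fixes k n m :: nat
  assumes "k * n \<le> m" "m < k * n + n"
  shows "m div n = k"
  by (rule div_nat_eqI) (use assms in \<open>simp_all add: algebra_simps\<close>)

text \<open>Standard factorisation: \<open>det\<close> makes a1/n1 < a2/n2 Farey neighbours, so the
  triangle between the segment to \<open>(n1 + n2, a1 + a2)\<close> and the broken line through
  \<open>(n1, a1)\<close> contains no lattice point besides its corners. Hence the floors along the
  segment and along the broken line agree.\<close>

lemma christoffel_append:
  assumes det: "a2 * n1 = a1 * n2 + (1::nat)" and "n2 > 0"
  shows "christoffel L (a1 + a2) (n1 + n2) = christoffel L a1 n1 @ christoffel L a2 n2"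
proof -
  define n a where "n = n1 + n2" and "a = a1 + a2"
  have n1: "n1 > 0"
    using det by (cases n1) auto
  have f1: "(i * a) div n = (i * a1) div n1" if "i \<le> n1" for i
  proof -
    define k r where "k = (i * a1) div n1" and "r = (i * a1) mod n1"
    have e: "i * a1 = k * n1 + r"
      unfolding k_def r_def by (rule div_mult_mod_eq[symmetric])
    have r: "r < n1"
      using n1 unfolding r_def by (rule mod_less_divisor)
    \<comment> \<open>At abscissa \<open>i\<close> the segment exceeds the first edge by i / (n *
      n1). As \<open>r \<le> n1 - 1\<close> and \<open>i \<le> n1 < n\<close>, the excess does not
      reach \<open>k + 1\<close>.\<close>
    have eq: "n1 * (i * a) = n1 * (k * n) + r * n + i"
    proof -
      have "n1 * (i * a) = (i * a1) * n1 + i * (a2 * n1)"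
        by (simp add: a_def algebra_simps)
      also have "\<dots> = (i * a1) * n + i"
        unfolding det n_def by (simp add: algebra_simps)
      also have "\<dots> = n1 * (k * n) + r * n + i"
        unfolding e by (simp add: algebra_simps)
      finally show ?thesis .
    qed
    have "n1 * (k * n) \<le> n1 * (i * a)"
      unfolding eq by simp
    then have lo: "k * n \<le> i * a"
      using n1 by simp
    have "r * n + i < n1 * n"
    proof -
      have "r * n + i < r * n + n"
        using that \<open>n2 > 0\<close> by (simp add: n_def)
      also have "\<dots> = (r + 1) * n" by simp
      also have "\<dots> \<le> n1 * n"
        using r by (intro mult_right_mono) auto
      finally show ?thesis .
    qed
    then have "n1 * (i * a) < n1 * (k * n + n)"
      unfolding eq by (simp add: algebra_simps)
    then have "i * a < k * n + n"
      using n1 by simp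
    with lo show ?thesis
      unfolding k_def[symmetric] by (rule nat_div_eqI)
  qed
  have f2: "((n1 + j) * a) div n = a1 + (j * a2) div n2" if jn: "j \<le> n2" for j
  proof -
    define k r where "k = (j * a2) div n2" and "r = (j * a2) mod n2"
    have e: "j * a2 = k * n2 + r"
      unfolding k_def r_def by (rule div_mult_mod_eq[symmetric])
    have r: "r < n2"
      using \<open>n2 > 0\<close> unfolding r_def by (rule mod_less_divisor)
    \<comment> \<open>After the corner the excess is n2 - j in units of 1 / (n * n2), falling to 0
      at the end; it stays below \<open>n\<close> because \<open>n1 > 0\<close>.\<close>
    have eq: "n2 * ((n1 + j) * a) = n2 * ((a1 + k) * n) + r * n + (n2 - j)"
    proof -
      obtain l where l: "n2 = j + l"
        using jn le_Suc_ex by blast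
      have "n2 * ((n1 + j) * a) + j = n2 * (n1 * a1) + n2 * (a2 * n1) + n2 * (j * a1) + j * a2 * n2 + j"
        by (simp add: a_def algebra_simps)
      also have "\<dots> = n2 * (n1 * a1) + n2 * (a1 * n2 + 1) + j * (a1 * n2 + 1) + j * a2 * n2"
        unfolding det by (simp add: algebra_simps)
      also have "\<dots> = n2 * (n1 * a1) + n2 * (a1 * n2 + 1) + j * (a2 * n1) + j * a2 * n2"
        unfolding det ..
      also have "\<dots> = n2 * (a1 * n) + n2 + (j * a2) * n"
        by (simp add: n_def algebra_simps)
      also have "\<dots> = n2 * ((a1 + k) * n) + r * n + n2"
        unfolding e by (simp add: algebra_simps)
      finally show ?thesis
        using jn by linarith
    qed
    have "n2 * ((a1 + k) * n) \<le> n2 * ((n1 + j) * a)"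
      unfolding eq by simp
    then have lo: "(a1 + k) * n \<le> (n1 + j) * a"
      using \<open>n2 > 0\<close> by (subst (asm) mult_le_cancel1) simp
    have "r * n + (n2 - j) < n2 * n"
    proof -
      have "r * n + (n2 - j) < r * n + n"
        using n1 by (simp add: n_def)
      also have "\<dots> = (r + 1) * n" by simp
      also have "\<dots> \<le> n2 * n"
        using r by (intro mult_right_mono) auto
      finally show ?thesis .
    qed
    then have "n2 * ((n1 + j) * a) < n2 * ((a1 + k) * n + n)"
      unfolding eq by (simp add: algebra_simps)
    then have "(n1 + j) * a < (a1 + k) * n + n"
      using \<open>n2 > 0\<close> by (subst (asm) mult_less_cancel1) simp
    with lo show ?thesis
      unfolding k_def[symmetric] by (rule nat_div_eqI)
  qed
  show ?thesis
  proof (rule nth_equalityI)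
    fix i assume "i < length (christoffel L (a1 + a2) (n1 + n2))"
    then have i: "i < n"
      by (simp add: christoffel_def n_def del: upt_Suc)
    have lhs: "christoffel L (a1 + a2) (n1 + n2) ! i =
        (if (Suc i * a) div n > (i * a) div n then L else LX)"
      using i by (simp add: christoffel_def n_def a_def del: upt_Suc)
    show "christoffel L (a1 + a2) (n1 + n2) ! i = (christoffel L a1 n1 @ christoffel L a2 n2) ! i"
    proof (cases "i < n1")
      case True
      then show ?thesis
        unfolding lhs using f1[of i] f1[of "Suc i"]
        by (simp add: christoffel_def nth_append del: upt_Suc)
    next
      case False
      then obtain j where j: "i = n1 + j" "j < n2"
        using i by (metis add_less_cancel_left le_Suc_ex n_def not_le)
      then show ?thesis
        unfolding lhs using f2[of j] f2[of "Suc j"]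
        by (simp add: christoffel_def nth_append del: upt_Suc)
    qed
  qed (simp add: christoffel_def del: upt_Suc)
qed

section \<open>Traces of Christoffel words within one cone\<close>

lemma word_mat_append: "word_mat A B (u @ v) = word_mat A B u ** word_mat A B v"
  by (induction u) (simp_all add: word_mat_def matrix_mul_assoc)

lemma det_word_mat:
  assumes "A \<in> SL2C" "B \<in> SL2C"
  shows "det (word_mat A B w) = 1"
proof (induction w)
  case (Cons l w)
  have "det (letter_mat A B l) = 1"
    using assms by (cases l) (auto simp: letter_mat_def SL2C_def matrix_inv_det_1)
  with Cons show ?case
    by (simp add: word_mat_def det_mul)
qed (simp add: word_mat_def)

text \<open>\<open>(p, q)\<close> is a lattice vector in one quadrant and counts the letters
  \<open>L\<close> and \<open>LX\<close>; the choice of \<open>L\<close> selects the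
  quadrant.\<close>

definition cone_trace :: "complex^2^2 \<Rightarrow> complex^2^2 \<Rightarrow> letter \<Rightarrow> nat \<Rightarrow> nat \<Rightarrow> complex" where
  "cone_trace A B L p q = trace (word_mat A B (christoffel L p (p + q)))"

lemma cone_trace_simps [simp]:
  "cone_trace A B L 0 (Suc 0) = trace A"
  "cone_trace A B LY (Suc 0) 0 = trace B"
  "cone_trace A B LYi (Suc 0) 0 = trace (matrix_inv B)"
  by (simp_all add: cone_trace_def christoffel_def word_mat_def letter_mat_def)

context
  fixes A B :: "complex^2^2" and L :: letter
  assumes AB: "A \<in> SL2C" "B \<in> SL2C"
begin

private abbreviation (input) "W p q \<equiv> word_mat A B (christoffel L p (p + q))"

lemma word_mat_christoffel_add:
  assumes "p2 * q1 = p1 * q2 + 1"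
  shows "W (p1 + p2) (q1 + q2) = W p1 q1 ** W p2 q2"
proof -
  have "p2 > 0"
    using assms by (cases p2) auto
  then have "christoffel L (p1 + p2) ((p1 + q1) + (p2 + q2)) =
      christoffel L p1 (p1 + q1) @ christoffel L p2 (p2 + q2)"
    by (intro christoffel_append) (use assms in \<open>simp_all add: algebra_simps\<close>)
  then show ?thesis
    by (simp add: word_mat_append add_ac)
qed

text \<open>The larger word starts with the smaller one: the difference vector satisfies the same
  determinant equation, so W2 = W1 W and the word of the sum is W1 W1 W. This is the situation of
  \<open>trace_cayley_left\<close>.\<close>

lemma cone_trace_edge_up:
  assumes "p2 * q1 = p1 * q2 + 1" "p1 \<le> p2" "q1 \<le> q2"
  shows "cone_trace A B L (p1 + p2) (q1 + q2) + cone_trace A B L (p2 - p1) (q2 - q1) =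
      cone_trace A B L p1 q1 * cone_trace A B L p2 q2"
proof -
  obtain p q where pq: "p2 = p1 + p" "q2 = q1 + q"
    by (metis assms(2,3) le_Suc_ex)
  have "W p2 q2 = W p1 q1 ** W p q"
    unfolding pq using assms(1) by (intro word_mat_christoffel_add) (simp add: pq algebra_simps)
  moreover have "W (p1 + p2) (q1 + q2) = W p1 q1 ** W p2 q2"
    using assms(1) by (rule word_mat_christoffel_add)
  ultimately show ?thesis
    using trace_cayley_left[OF det_word_mat[OF AB], of "christoffel L p1 (p1 + q1)" "W p q"]
    by (simp add: cone_trace_def pq)
qed

lemma cone_trace_edge_down:
  assumes "p2 * q1 = p1 * q2 + 1" "p2 \<le> p1" "q2 \<le> q1"
  shows "cone_trace A B L (p1 + p2) (q1 + q2) + cone_trace A B L (p1 - p2) (q1 - q2) =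
      cone_trace A B L p1 q1 * cone_trace A B L p2 q2"
proof -
  obtain p q where pq: "p1 = p2 + p" "q1 = q2 + q"
    by (metis assms(2,3) le_Suc_ex)
  have "W (p + p2) (q + q2) = W p q ** W p2 q2"
    using assms(1) by (intro word_mat_christoffel_add) (simp add: pq algebra_simps)
  then have "W p1 q1 = W p q ** W p2 q2"
    by (simp add: pq add_ac)
  moreover have "W (p1 + p2) (q1 + q2) = W p1 q1 ** W p2 q2"
    using assms(1) by (rule word_mat_christoffel_add)
  ultimately show ?thesis
    using trace_cayley_right[OF det_word_mat[OF AB], of "W p q" "christoffel L p2 (p2 + q2)"]
    by (simp add: cone_trace_def pq matrix_mul_assoc)
qed

end

lemma trace_matrix_inv:
  fixes B :: "complex^2^2"
  assumes "det B = 1"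
  shows "trace (matrix_inv B) = trace B"
  using trace_cayley_left[OF assms, of "matrix_inv B"] trace_I[where 'n=2 and 'a=complex]
  by (simp add: matrix_inv_det_1[OF assms] matrix_mul_rid)

text \<open>The edge of the two unit vectors, whose sum and difference lie in different cones: they
  are the curves XY and X Y^-1.\<close>

lemma cone_trace_edge_base:
  assumes "A \<in> SL2C" "B \<in> SL2C"
  shows "cone_trace A B LY 1 1 + cone_trace A B LYi 1 1 = trace A * trace B"
proof -
  have B: "det B = 1"
    using assms by (simp add: SL2C_def)
  have w: "cone_trace A B LY 1 1 = trace (A ** B)" "cone_trace A B LYi 1 1 = trace (A ** matrix_inv B)"
    by (simp_all add: cone_trace_def christoffel_def word_mat_def letter_mat_def matrix_mul_rid)
  have "A ** matrix_inv B ** B = A"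
    by (metis matrix_inv_det_1(2)[OF B] matrix_mul_assoc matrix_mul_rid)
  then show ?thesis
    unfolding w using trace_cayley_right[OF B, of "A ** matrix_inv B"] by simp
qed

subsection \<open>Markoff maps on primitive integer vectors\<close>

lemma coprime_of_det:
  fixes a b c d :: int
  assumes "\<bar>a * d - b * c\<bar> = 1"
  shows "coprime a b" "coprime c d"
proof -
  have *: "k dvd 1" if "k dvd a * d - b * c" for k
    using that assms by (metis dvd_abs_iff)
  show "coprime a b" "coprime c d"
    by (rule coprimeI, rule *, simp)+
qed

text \<open>Glues two cone functions: \<open>L\<close> serves the quadrants with
  \<open>a * b \<ge> 0\<close>, axes included, and \<open>L'\<close> the other two. The letters are
  parameters because a reflection in an axis exchanges them.\<close>

definition fold_trace :: "complex^2^2 \<Rightarrow> complex^2^2 \<Rightarrow> letter \<Rightarrow> letter \<Rightarrow> int \<Rightarrow> int \<Rightarrow> complex" where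
  "fold_trace A B L L' a b = cone_trace A B (if a * b \<ge> 0 then L else L') (nat \<bar>a\<bar>) (nat \<bar>b\<bar>)"

lemma fold_trace_minus: "fold_trace A B L L' (- a) (- b) = fold_trace A B L L' a b"
  by (simp add: fold_trace_def)

context
  fixes A B :: "complex^2^2"
  assumes AB: "A \<in> SL2C" "B \<in> SL2C"
begin

text \<open>Off the axes the reflection exchanges the cones. On an axis the sign test always picks
  the first letter, so the two sides use different letters; but a primitive vector there is a unit
  vector, and \<open>B\<close> and its inverse have the same trace.\<close>

lemma fold_trace_reflect:
  assumes "coprime a b"
  shows "fold_trace A B LY LYi (- a) b = fold_trace A B LYi LY a b"
proof -
  have "trace (matrix_inv B) = trace B"
    using AB by (intro trace_matrix_inv) (simp add: SL2C_def)
  moreover have "\<bar>b\<bar> = 1" if "a = 0"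
    using assms that by simp
  moreover have "\<bar>a\<bar> = 1" if "b = 0"
    using assms that by simp
  ultimately show ?thesis
    by (cases "a = 0 \<or> b = 0") (auto simp: fold_trace_def mult_le_0_iff zero_le_mult_iff)
qed

lemma fold_trace_edge_nonneg:
  assumes L: "(L, L') \<in> {(LY, LYi), (LYi, LY)}"
    and nonneg: "a \<ge> 0" "b \<ge> 0" "c \<ge> 0" "d \<ge> 0" and det: "c * b = a * d + 1"
  shows "fold_trace A B L L' (a + c) (b + d) + fold_trace A B L L' (a - c) (b - d) =
    fold_trace A B L L' a b * fold_trace A B L L' c d"
proof -
  obtain p1 q1 p2 q2 where eq: "a = int p1" "b = int q1" "c = int p2" "d = int q2"
    using nonneg[THEN zero_le_imp_eq_int] by blast
  have det': "p2 * q1 = p1 * q2 + 1"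
    using det unfolding eq by (metis of_nat_1 of_nat_add of_nat_eq_iff of_nat_mult)
  have nat_pos: "fold_trace A B L L' (int p) (int q) = cone_trace A B L p q" for p q
    by (simp add: fold_trace_def)
  have sum: "fold_trace A B L L' (a + c) (b + d) = cone_trace A B L (p1 + p2) (q1 + q2)"
    using nat_pos[of "p1 + p2" "q1 + q2"] by (simp add: eq)
  consider "p1 \<le> p2" "q1 \<le> q2" | "p2 \<le> p1" "q2 \<le> q1" | "p1 < p2" "q2 < q1" | "p2 < p1" "q1 < q2"
    by linarith
  then show ?thesis
  proof cases
    case 1
    then have "fold_trace A B L L' (a - c) (b - d) = cone_trace A B L (p2 - p1) (q2 - q1)"
      using nat_pos[of "p2 - p1" "q2 - q1"] fold_trace_minus[of A B L L' "c - a" "d - b"]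
      by (simp add: eq)
    then show ?thesis
      using cone_trace_edge_up[OF AB det' 1, of L] unfolding sum by (simp add: eq nat_pos)
  next
    case 2
    then have "fold_trace A B L L' (a - c) (b - d) = cone_trace A B L (p1 - p2) (q1 - q2)"
      using nat_pos[of "p1 - p2" "q1 - q2"] by (simp add: eq)
    then show ?thesis
      using cone_trace_edge_down[OF AB det' 2, of L] unfolding sum by (simp add: eq nat_pos)
  next
    case 3
    \<comment> \<open>The vectors are incomparable. Determinant one then leaves only the two unit
      vectors, whose difference leaves the cone.\<close>
    then have "Suc p1 * Suc q2 \<le> p2 * q1"
      by (intro mult_le_mono) auto
    then have z: "p1 = 0" "q2 = 0"
      using det' by simp_all
    then have o: "p2 = 1" "q1 = 1"
      using det' by simp_all
    have "trace (matrix_inv B) = trace B"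
      using AB by (intro trace_matrix_inv) (simp add: SL2C_def)
    then show ?thesis
      using L cone_trace_edge_base[OF AB] z o by (auto simp: eq fold_trace_def add_ac)
  next
    case 4
    then have "p2 * q1 \<le> p1 * q2"
      by (intro mult_le_mono) auto
    then show ?thesis
      using det' by simp
  qed
qed

text \<open>The relation is symmetric in the two vectors, and negating one of them merely exchanges
  sum and difference, so both can be moved into the closed first quadrant.\<close>

lemma fold_trace_edge_pos_slope:
  assumes L: "(L, L') \<in> {(LY, LYi), (LYi, LY)}"
    and sgn: "a * b \<ge> 0" "c * d \<ge> 0" and det: "\<bar>a * d - b * c\<bar> = 1"
  shows "fold_trace A B L L' (a + c) (b + d) + fold_trace A B L L' (a - c) (b - d) =
    fold_trace A B L L' a b * fold_trace A B L L' c d" (is "?E a b c d")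
proof -
  have swap: "?E a b c d" if "?E c d a b" for a b c d
  proof -
    have "fold_trace A B L L' (c - a) (d - b) = fold_trace A B L L' (a - c) (b - d)"
      using fold_trace_minus[of A B L L' "a - c" "b - d"] by simp
    then show ?thesis
      using that by (simp add: add.commute mult.commute)
  qed
  have neg: "?E a b c d" if "?E (- a) (- b) c d" for a b c d
  proof -
    have "fold_trace A B L L' (- a + c) (- b + d) = fold_trace A B L L' (a - c) (b - d)"
      using fold_trace_minus[of A B L L' "a - c" "b - d"] by simp
    moreover have "fold_trace A B L L' (- a - c) (- b - d) = fold_trace A B L L' (a + c) (b + d)"
      using fold_trace_minus[of A B L L' "a + c" "b + d"] by simp
    ultimately show ?thesis
      using that by (simp only: fold_trace_minus add.commute)
  qed
  have neg2: "?E a b c d" if "?E a b (- c) (- d)" for a b c d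
    by (rule swap[OF neg[OF swap[OF that]]])
  have pos: "?E a b c d" if "a \<ge> 0" "b \<ge> 0" "c \<ge> 0" "d \<ge> 0" "\<bar>a * d - b * c\<bar> = 1" for a b c d
  proof (cases "a * d - b * c = 1")
    case True
    show ?thesis
      by (rule swap, rule fold_trace_edge_nonneg[OF L]) (use that True in \<open>simp_all add: algebra_simps\<close>)
  next
    case False
    then have "a * d - b * c = -1"
      using that by linarith
    then show ?thesis
      by (intro fold_trace_edge_nonneg[OF L]) (use that in \<open>simp_all add: algebra_simps\<close>)
  qed
  have right: "?E a b c d" if "a \<ge> 0" "b \<ge> 0" "c * d \<ge> 0" "\<bar>a * d - b * c\<bar> = 1" for a b c d
  proof (cases "c \<ge> 0 \<and> d \<ge> 0")
    case True
    then show ?thesis using that by (intro pos) auto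
  next
    case False
    then have "c \<le> 0" "d \<le> 0"
      using that(3) by (auto simp: zero_le_mult_iff)
    moreover have "\<bar>a * - d - b * - c\<bar> = 1"
      using that(4) by simp
    ultimately show ?thesis using that by - (rule neg2, rule pos, auto)
  qed
  show ?thesis
  proof (cases "a \<ge> 0 \<and> b \<ge> 0")
    case True
    then show ?thesis using sgn det by (intro right) auto
  next
    case False
    then have "a \<le> 0" "b \<le> 0"
      using sgn(1) by (auto simp: zero_le_mult_iff)
    moreover have "\<bar>- a * d - - b * c\<bar> = 1"
      using det by simp
    ultimately show ?thesis using sgn by - (rule neg, rule right, auto)
  qed
qed

lemma fold_trace_edge:
  assumes det: "\<bar>a * d - b * c\<bar> = 1"
  shows "fold_trace A B LY LYi (a + c) (b + d) + fold_trace A B LY LYi (a - c) (b - d) =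
    fold_trace A B LY LYi a b * fold_trace A B LY LYi c d"
proof -
  \<comment> \<open>Vectors in the interiors of different cones give \<open>a * d\<close> and
    \<open>b * c\<close> opposite signs, hence a determinant of size at least 2. So every basis lies
    in one pair of opposite closed quadrants.\<close>
  have no: False if "a * b > 0" "c * d < 0" "\<bar>a * d - b * c\<bar> = 1" for a b c d :: int
  proof -
    have "(a * d) * (b * c) = (a * b) * (c * d)"
      by (simp add: algebra_simps)
    also have "\<dots> < 0"
      using that(1,2) by (rule mult_pos_neg)
    finally have "a * d > 0 \<and> b * c < 0 \<or> a * d < 0 \<and> b * c > 0"
      by (simp only: mult_less_0_iff[of "a * d"])
    then show False
      using that(3) by linarith
  qed
  have "\<bar>c * b - d * a\<bar> = 1"
    using det by (simp add: mult.commute abs_minus_commute)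
  then have "\<not> (a * b > 0 \<and> c * d < 0)" "\<not> (c * d > 0 \<and> a * b < 0)"
    using no[of a b c d] no[of c d a b] det by auto
  then have "a * b \<ge> 0 \<and> c * d \<ge> 0 \<or> a * b \<le> 0 \<and> c * d \<le> 0"
    by linarith
  then consider "a * b \<ge> 0" "c * d \<ge> 0" | "a * b \<le> 0" "c * d \<le> 0"
    by blast
  then show ?thesis
  proof cases
    case 1
    then show ?thesis
      using det by (intro fold_trace_edge_pos_slope) auto
  next
    case 2
    \<comment> \<open>Negating the first coordinates turns nonpositive slopes into nonnegative ones,
      with the letters exchanged.\<close>
    have "\<bar>- a * d - b * - c\<bar> = 1"
      using det by simp
    then have *: "fold_trace A B LYi LY (- a + - c) (b + d) + fold_trace A B LYi LY (- a - - c) (b - d) =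
        fold_trace A B LYi LY (- a) b * fold_trace A B LYi LY (- c) d"
      using 2 by (intro fold_trace_edge_pos_slope) auto
    have r: "fold_trace A B LYi LY (- x) y = fold_trace A B LY LYi x y" if "coprime x y" for x y
      using fold_trace_reflect[of "- x" y] that by simp
    have "coprime (a + c) (b + d)" "coprime (a - c) (b - d)"
      using coprime_of_det(1)[of "a + c" d "b + d" c] coprime_of_det(1)[of "a - c" d "b - d" c] det
      by (simp_all add: algebra_simps)
    then show ?thesis
      using * r[of "a + c" "b + d"] r[of "a - c" "b - d"] r[of a b] r[of c d] coprime_of_det[OF det]
      by simp
  qed
qed

end

text \<open>A primitive vector up to sign is an unoriented curve, and a basis is a pair of curves
  meeting once. Its sum and difference are the two ways to resolve the crossing, which is the source
  of \<open>edge\<close>.\<close>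

locale markoff_map =
  fixes f :: "int \<Rightarrow> int \<Rightarrow> complex"
  assumes minus: "f (- a) (- b) = f a b"
    and edge: "\<bar>a * d - b * c\<bar> = 1 \<Longrightarrow> f (a + c) (b + d) + f (a - c) (b - d) = f a b * f c d"

lemma markoff_map_fold_trace:
  assumes "A \<in> SL2C" "B \<in> SL2C"
  shows "markoff_map (fold_trace A B LY LYi)"
  using assms by unfold_locales (simp_all add: fold_trace_minus fold_trace_edge)

lemma curve_trace_eq_fold_trace:
  assumes "A \<in> SL2C" "B \<in> SL2C" and "(p, q) \<in> curves"
  shows "curve_trace A B (p, q) = fold_trace A B LY LYi p q"
proof -
  have "curve_word (p, q) = christoffel (if p \<ge> 0 then LY else LYi) (nat \<bar>p\<bar>) (nat \<bar>p\<bar> + nat q)"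
    by (simp add: curve_word_def christoffel_def Let_def add.commute)
  moreover have "q \<ge> 0" "p < 0 \<longrightarrow> q > 0"
    using assms(3) by (auto simp: curves_def)
  ultimately show ?thesis
    by (auto simp: curve_trace_def fold_trace_def cone_trace_def zero_le_mult_iff)
qed

lemma curves_coprime:
  assumes "coprime a b"
  shows "(a, b) \<in> curves \<or> (- a, - b) \<in> curves"
proof (cases "b = 0")
  case True
  then show ?thesis
    using assms by (auto simp: curves_def)
qed (use assms in \<open>auto simp: curves_def\<close>)

section \<open>Induction over bases of the integer lattice\<close>

text \<open>Row operations: the Euclidean algorithm on the first column.\<close>

lemma unimodular_induct_standard:
  fixes P :: "int \<Rightarrow> int \<Rightarrow> int \<Rightarrow> int \<Rightarrow> bool"
  assumes std: "P 1 0 0 1"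
    and swap: "\<And>a b c d. P a b c d \<Longrightarrow> P c d a b"
    and neg: "\<And>a b c d. P a b c d \<Longrightarrow> P (- a) (- b) c d"
    and add: "\<And>a b c d. P a b c d \<Longrightarrow> P (a + c) (b + d) c d"
    and det: "\<bar>a * d - b * c\<bar> = 1"
  shows "P a b c d"
proof -
  have neg2: "P a b c d" if "P a b (- c) (- d)" for a b c d
    using swap[OF neg[OF swap[OF that]]] by simp
  have sub: "P (a - c) (b - d) c d" if "P a b c d" for a b c d
    using neg[OF add[OF neg[OF that]]] by simp
  have mul: "P (a + k * c) (b + k * d) c d" if "P a b c d" for a b c d k
  proof (induction k rule: int_induct[where k = 0])
    case (step1 i)
    then show ?case using add[OF step1(2)] by (simp add: algebra_simps)
  next
    case (step2 i)
    then show ?case using sub[OF step2(2)] by (simp add: algebra_simps)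
  qed (use that in simp)
  show ?thesis
    using det
  proof (induction "nat (\<bar>a\<bar> + \<bar>c\<bar>)" arbitrary: a b c d rule: less_induct)
    case less
    \<comment> \<open>Adding or subtracting the second row, depending on the signs, shrinks
      \<open>\<bar>a\<bar>\<close>. The bound \<open>n\<close> and the hypothesis \<open>IH\<close>
      are parameters so that the step also serves the swapped rows.\<close>
    have step: "P a b c d" if h: "\<bar>c\<bar> \<le> \<bar>a\<bar>" "c \<noteq> 0" "\<bar>a * d - b * c\<bar> = 1"
        "nat (\<bar>a\<bar> + \<bar>c\<bar>) \<le> n" and IH: "\<And>a' b' c' d'. nat (\<bar>a'\<bar> + \<bar>c'\<bar>) < n \<Longrightarrow>
          \<bar>a' * d' - b' * c'\<bar> = 1 \<Longrightarrow> P a' b' c' d'" for a b c d n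
    proof (cases "sgn a = sgn c")
      case True
      have "P (a - c) (b - d) c d"
      proof (rule IH)
        show "nat (\<bar>a - c\<bar> + \<bar>c\<bar>) < n"
          using h True by (auto simp: sgn_if split: if_splits)
        show "\<bar>(a - c) * d - (b - d) * c\<bar> = 1"
          using h(3) by (simp add: algebra_simps)
      qed
      then show ?thesis
        using add[of "a - c" "b - d" c d] by simp
    next
      case False
      have "P (a + c) (b + d) c d"
      proof (rule IH)
        show "nat (\<bar>a + c\<bar> + \<bar>c\<bar>) < n"
          using h False by (auto simp: sgn_if split: if_splits)
        show "\<bar>(a + c) * d - (b + d) * c\<bar> = 1"
          using h(3) by (simp add: algebra_simps)
      qed
      then show ?thesis
        using sub[of "a + c" "b + d" c d] by simp
    qed
    have c0: "P a b 0 d" if "\<bar>a * d\<bar> = 1" for a b d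
    proof -
      have a: "a = 1 \<or> a = -1" and d: "d = 1 \<or> d = -1"
        using abs_zmult_eq_1[of a d] abs_zmult_eq_1[of d a] that by (simp_all add: mult.commute abs_eq_iff')
      have "P 1 k 0 1" for k
        using mul[OF std, of k] by simp
      then have "P 1 k 0 d" for k
        using d neg2[of 1 k 0 "-1"] by auto
      then show ?thesis
        using a neg[of 1 "- b" 0 d] by auto
    qed
    consider "c = 0" | "a = 0" | "c \<noteq> 0" "\<bar>c\<bar> \<le> \<bar>a\<bar>" | "a \<noteq> 0" "\<bar>a\<bar> \<le> \<bar>c\<bar>"
      by linarith
    then show ?case
    proof cases
      case 1
      then show ?thesis using less.prems c0[of a d b] by simp
    next
      case 2
      then show ?thesis using less.prems swap[OF c0[of c b d]] by (simp add: mult.commute)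
    next
      case 3
      then show ?thesis
        by (intro step[OF _ _ less.prems order_refl less.hyps])
    next
      case 4
      have "\<bar>c * b - d * a\<bar> = 1"
        using less.prems by (simp add: algebra_simps abs_minus_commute)
      moreover have "nat (\<bar>c\<bar> + \<bar>a\<bar>) \<le> nat (\<bar>a\<bar> + \<bar>c\<bar>)" by simp
      ultimately have "P c d a b"
        by (rule step[OF 4(2,1) _ _ less.hyps])
      then show ?thesis by (rule swap)
    qed
  qed
qed

text \<open>Row operations commute with multiplication by the starting matrix from the right, so the
  standard induction can run on coordinates relative to the starting basis.\<close>

lemma unimodular_induct [consumes 2, case_names init swap neg add]:
  fixes P :: "int \<Rightarrow> int \<Rightarrow> int \<Rightarrow> int \<Rightarrow> bool"
  assumes det: "\<bar>a * d - b * c\<bar> = 1" and det0: "\<bar>a0 * d0 - b0 * c0\<bar> = 1"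
    and init: "P a0 b0 c0 d0"
    and swap: "\<And>a b c d. \<bar>a * d - b * c\<bar> = 1 \<Longrightarrow> P a b c d \<Longrightarrow> P c d a b"
    and neg: "\<And>a b c d. \<bar>a * d - b * c\<bar> = 1 \<Longrightarrow> P a b c d \<Longrightarrow> P (- a) (- b) c d"
    and add: "\<And>a b c d. \<bar>a * d - b * c\<bar> = 1 \<Longrightarrow> P a b c d \<Longrightarrow> P (a + c) (b + d) c d"
  shows "P a b c d"
proof -
  define R where "R a b c d \<longleftrightarrow> \<bar>a * d - b * c\<bar> = 1 \<and>
      P (a * a0 + b * c0) (a * b0 + b * d0) (c * a0 + d * c0) (c * b0 + d * d0)" for a b c d
  have det_mult: "\<bar>(a * a0 + b * c0) * (c * b0 + d * d0) - (a * b0 + b * d0) * (c * a0 + d * c0)\<bar> =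
      \<bar>a * d - b * c\<bar>" for a b c d
  proof -
    have "(a * a0 + b * c0) * (c * b0 + d * d0) - (a * b0 + b * d0) * (c * a0 + d * c0) =
        (a * d - b * c) * (a0 * d0 - b0 * c0)"
      by (simp add: algebra_simps)
    then show ?thesis
      using det0 by (simp add: abs_mult)
  qed
  define e where "e = a0 * d0 - b0 * c0"
  have ee: "e * e = 1"
    using det0 unfolding e_def[symmetric] by (metis abs_mult_self_eq mult_1)
  \<comment> \<open>The rows times the inverse of the starting matrix. Its determinant
    \<open>e\<close> is a sign, so division by \<open>e\<close> is multiplication by
    \<open>e\<close>.\<close>
  define a' b' c' d' where "a' = e * (a * d0 - b * c0)" and "b' = e * (a0 * b - b0 * a)"
    and "c' = e * (c * d0 - d * c0)" and "d' = e * (a0 * d - b0 * c)"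
  have eqs: "a' * a0 + b' * c0 = a" "a' * b0 + b' * d0 = b" "c' * a0 + d' * c0 = c" "c' * b0 + d' * d0 = d"
  proof -
    have "a' * a0 + b' * c0 = e * e * a" "a' * b0 + b' * d0 = e * e * b"
        "c' * a0 + d' * c0 = e * e * c" "c' * b0 + d' * d0 = e * e * d"
      unfolding a'_def b'_def c'_def d'_def e_def by (simp_all add: algebra_simps)
    then show "a' * a0 + b' * c0 = a" "a' * b0 + b' * d0 = b" "c' * a0 + d' * c0 = c" "c' * b0 + d' * d0 = d"
      by (simp_all add: ee)
  qed
  have "R a' b' c' d'"
  proof (rule unimodular_induct_standard)
    show "R 1 0 0 1"
      using init by (simp add: R_def)
    show "R c d a b" if "R a b c d" for a b c d
      using that swap[OF _ conjunct2[OF that[unfolded R_def]]] det_mult[of a b c d]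
      by (simp add: R_def abs_minus_commute algebra_simps)
    show "R (- a) (- b) c d" if "R a b c d" for a b c d
      using that neg[OF _ conjunct2[OF that[unfolded R_def]]] det_mult[of a b c d]
      by (simp add: R_def abs_minus_commute algebra_simps)
    show "R (a + c) (b + d) c d" if "R a b c d" for a b c d
      using that add[OF _ conjunct2[OF that[unfolded R_def]]] det_mult[of a b c d]
      by (simp add: R_def algebra_simps)
    show "\<bar>a' * d' - b' * c'\<bar> = 1"
      using det det_mult[of a' b' c' d'] unfolding eqs by simp
  qed
  then show ?thesis
    by (simp add: R_def eqs)
qed

subsection \<open>Second-order recurrences\<close>

text \<open>For x = 2 cos s and y = 2 cos t, the expression in \<open>m\<close> equals 4 at z = 2
  cos (s + t) and z = 2 cos (s - t). The bound puts \<open>z\<close> between these roots, and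
  \<open>x * y - z\<close> is its mirror image in their midpoint.\<close>

lemma abs_flip_le_2:
  fixes x y z :: real
  assumes "\<bar>x\<bar> \<le> 2" "\<bar>y\<bar> \<le> 2" and m: "x\<^sup>2 + y\<^sup>2 + z\<^sup>2 - x * y * z \<le> 4"
  shows "\<bar>x * y - z\<bar> \<le> 2"
proof -
  have xy: "\<bar>x\<bar> * \<bar>y\<bar> \<le> 2 * 2"
    using assms by (intro mult_mono) auto
  have "(2 * z - x * y)\<^sup>2 = (4 - x\<^sup>2) * (4 - y\<^sup>2) + 4 * (x\<^sup>2 + y\<^sup>2 + z\<^sup>2 - x * y * z - 4)"
    by (simp add: power2_eq_square algebra_simps)
  also have "\<dots> \<le> (4 - x\<^sup>2) * (4 - y\<^sup>2)"
    using m by simp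
  also have "\<dots> = (4 - \<bar>x\<bar> * \<bar>y\<bar>)\<^sup>2 - 4 * (\<bar>x\<bar> - \<bar>y\<bar>)\<^sup>2"
    by (simp add: power2_eq_square algebra_simps abs_mult_self_eq)
  also have "\<dots> \<le> (4 - \<bar>x\<bar> * \<bar>y\<bar>)\<^sup>2"
    by simp
  finally have "\<bar>2 * z - x * y\<bar> \<le> \<bar>4 - \<bar>x\<bar> * \<bar>y\<bar>\<bar>"
    by (simp add: abs_le_square_iff)
  then have "\<bar>2 * z - x * y\<bar> \<le> 4 - \<bar>x * y\<bar>"
    using xy by (simp add: abs_mult)
  then show ?thesis
    by linarith
qed

definition elliptic_range :: "complex set" where
  "elliptic_range = of_real ` {-2..2}"

lemma elliptic_range_iff: "x \<in> elliptic_range \<longleftrightarrow> (\<exists>r. x = of_real r \<and> \<bar>r\<bar> \<le> 2)"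
  by (auto simp: elliptic_range_def abs_le_iff)

text \<open>The two roots have product 1. On the unit circle they would be conjugate, and their sum
  \<open>x\<close> would be real of size at most 2.\<close>

lemma exists_eigenvalue_norm_gt_1:
  assumes "x \<notin> elliptic_range"
  obtains l where "norm l > 1" "l + inverse l = x"
proof -
  define s where "s = csqrt (x\<^sup>2 - 4)"
  define l1 l2 where "l1 = (x + s) / 2" and "l2 = (x - s) / 2"
  have "s * s = x\<^sup>2 - 4"
    unfolding s_def using power2_csqrt[of "x\<^sup>2 - 4"] by (simp add: power2_eq_square)
  then have prod: "l1 * l2 = 1"
    by (simp add: l1_def l2_def field_simps power2_eq_square)
  have sum: "l1 + l2 = x"
    by (simp add: l1_def l2_def field_simps)
  have inv: "inverse l1 = l2" "inverse l2 = l1"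
    using prod inverse_unique[of l1 l2] inverse_unique[of l2 l1] by (simp_all add: mult.commute)
  have np: "norm l1 * norm l2 = 1"
    using prod by (metis norm_mult norm_one)
  have "norm l1 \<noteq> 1"
  proof
    assume n: "norm l1 = 1"
    then have "l1 * cnj l1 = 1"
      by (simp flip: complex_norm_square)
    then have "l2 = cnj l1"
      using inv(1) inverse_unique by metis
    then have "x = of_real (2 * Re l1)"
      using sum complex_add_cnj[of l1] by simp
    moreover have "\<bar>2 * Re l1\<bar> \<le> 2"
      using abs_Re_le_cmod[of l1] n by simp
    ultimately show False
      using assms unfolding elliptic_range_iff by blast
  qed
  then consider "norm l1 > 1" | "norm l1 < 1"
    by linarith
  then show thesis
  proof cases
    case 1
    then show thesis
      using sum inv by (intro that[of l1]) auto
  next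
    case 2
    have "norm l2 > 1"
    proof (rule ccontr)
      assume "\<not> norm l2 > 1"
      then have "norm l1 * norm l2 \<le> norm l1 * 1"
        by (intro mult_left_mono) auto
      with np 2 show False by simp
    qed
    then show thesis
      using sum inv by (intro that[of l2]) (auto simp: add.commute)
  qed
qed

text \<open>The combinations \<open>y (Suc n) - k * y n\<close> and
  \<open>y (Suc n) - l * y n\<close>, with \<open>k = inverse l\<close>, isolate the two
  eigencomponents. If the first vanishes, only decay is left; otherwise its power of
  \<open>l\<close> dominates.\<close>

lemma recurrence_dichotomy:
  fixes y :: "nat \<Rightarrow> complex"
  assumes l: "norm l > 1" and rec: "\<And>n. y (Suc (Suc n)) = (l + inverse l) * y (Suc n) - y n"
  shows "(\<forall>n. y n = inverse l ^ n * y 0) \<or> filterlim (\<lambda>n. norm (y n)) at_top sequentially"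
proof -
  have l0: "l \<noteq> 0"
    using l by auto
  define k where "k = inverse l"
  have lk: "l * k = 1" "k * l = 1"
    using l0 by (simp_all add: k_def)
  then have lk_cancel: "l * (k * z) = z" "k * (l * z) = z" for z
    by (simp_all add: mult.assoc[symmetric])
  have k1: "norm k \<le> 1"
    using l by (simp add: k_def norm_inverse inverse_le_1_iff)
  have rec': "y (Suc (Suc n)) = l * y (Suc n) + k * y (Suc n) - y n" for n
    using rec[of n] by (simp add: k_def algebra_simps)
  have p: "y (Suc n) - k * y n = l ^ n * (y 1 - k * y 0)" for n
  proof (induction n)
    case (Suc n)
    have "y (Suc (Suc n)) - k * y (Suc n) = l * (y (Suc n) - k * y n)"
      unfolding rec' by (simp add: algebra_simps lk_cancel)
    with Suc show ?case by simp
  qed simp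
  have q: "y (Suc n) - l * y n = k ^ n * (y 1 - l * y 0)" for n
  proof (induction n)
    case (Suc n)
    have "y (Suc (Suc n)) - l * y (Suc n) = k * (y (Suc n) - l * y n)"
      unfolding rec' by (simp add: algebra_simps lk_cancel)
    with Suc show ?case by simp
  qed simp
  show ?thesis
  proof (cases "y 1 - k * y 0 = 0")
    case True
    have "y n = k ^ n * y 0" for n
    proof (induction n)
      case (Suc n)
      have "y (Suc n) = k * y n"
        using p[of n] unfolding True by simp
      also have "\<dots> = k * (k ^ n * y 0)"
        by (simp only: Suc.IH)
      finally show ?case
        by (simp only: power_Suc mult.assoc)
    qed simp
    then show ?thesis
      unfolding k_def by (intro disjI1 allI)
  next
    case False
    define P Q D where "P = norm (y 1 - k * y 0)" and "Q = norm (y 1 - l * y 0)" and "D = norm (l - k)"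
    have "P > 0"
      using False by (simp add: P_def)
    have "D > 0"
    proof -
      have "norm l \<noteq> norm k"
        using l k1 by simp
      then show ?thesis by (auto simp: D_def)
    qed
    have bound: "(norm l ^ n * P - Q) / D \<le> norm (y n)" for n
    proof -
      \<comment> \<open>Subtracting the combinations recovers \<open>y n\<close> up to the factor
        \<open>l - k\<close>, which is nonzero because the norms of \<open>l\<close> and
        \<open>k\<close> differ.\<close>
      have "(l - k) * y n = (y (Suc n) - k * y n) - (y (Suc n) - l * y n)"
        by (simp add: algebra_simps)
      then have "(l - k) * y n = l ^ n * (y 1 - k * y 0) - k ^ n * (y 1 - l * y 0)"
        by (simp only: p q)
      then have eq: "D * norm (y n) = norm (l ^ n * (y 1 - k * y 0) - k ^ n * (y 1 - l * y 0))"
        unfolding D_def norm_mult[symmetric] by (rule arg_cong)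
      have "norm l ^ n * P - norm k ^ n * Q \<le> D * norm (y n)"
        unfolding eq
        using norm_triangle_ineq2[of "l ^ n * (y 1 - k * y 0)" "k ^ n * (y 1 - l * y 0)"]
        by (simp only: P_def Q_def norm_mult norm_power)
      moreover have "norm k ^ n * Q \<le> 1 * Q"
        using k1 by (intro mult_right_mono power_le_one) (auto simp: Q_def)
      ultimately have "norm l ^ n * P - Q \<le> norm (y n) * D"
        by (simp add: mult.commute)
      then show ?thesis
        using \<open>D > 0\<close> by (simp add: pos_divide_le_eq)
    qed
    have "filterlim (\<lambda>n. (norm l ^ n * P - Q) / D) at_top sequentially"
    proof -
      have "filterlim (\<lambda>n. norm l ^ n) at_top sequentially"
      proof (rule filterlim_at_infinity_imp_filterlim_at_top)
        show "filterlim (\<lambda>n. norm l ^ n) at_infinity sequentially"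
          using l by (intro filterlim_realpow_sequentially_gt1) simp
        show "\<forall>\<^sub>F n in sequentially. 0 < norm l ^ n"
          using l0 by (intro always_eventually) simp
      qed
      then have "filterlim (\<lambda>n. (P / D) * norm l ^ n) at_top sequentially"
        by (rule filterlim_tendsto_pos_mult_at_top[OF tendsto_const, rotated]) (simp add: \<open>P > 0\<close> \<open>D > 0\<close>)
      then have "filterlim (\<lambda>n. - (Q / D) + (P / D) * norm l ^ n) at_top sequentially"
        by (rule filterlim_tendsto_add_at_top[OF tendsto_const])
      then show ?thesis
        by (simp add: diff_divide_distrib mult.commute)
    qed
    then have "filterlim (\<lambda>n. norm (y n)) at_top sequentially"
      by (rule filterlim_at_top_mono) (intro always_eventually allI bound)
    then show ?thesis ..
  qed
qed

text \<open>A concave sequence that drops once keeps dropping at least at that rate and becomes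
  negative.\<close>

lemma concave_pos_mono:
  fixes d :: "nat \<Rightarrow> real"
  assumes pos: "\<And>n. d n > 0" and concave: "\<And>n. d (Suc (Suc n)) - d (Suc n) \<le> d (Suc n) - d n"
  shows "d 0 \<le> d n"
proof -
  have step: "d n \<le> d (Suc n)" for n
  proof (rule ccontr)
    assume "\<not> d n \<le> d (Suc n)"
    define e where "e = d n - d (Suc n)"
    have e: "e > 0"
      using \<open>\<not> d n \<le> d (Suc n)\<close> by (simp add: e_def)
    have de: "d (Suc (n + j)) - d (n + j) \<le> - e" for j
    proof (induction j)
      case (Suc j)
      then show ?case using concave[of "n + j"] by simp
    qed (simp add: e_def)
    have "d (n + j) \<le> d n - real j * e" for j
    proof (induction j)
      case (Suc j)
      then show ?case using de[of j] by (simp add: algebra_simps)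
    qed simp
    moreover obtain j where "d n < real j * e"
      using reals_Archimedean3[OF e] by blast
    ultimately show False
      using pos[of "n + j"] by (smt (verit))
  qed
  show ?thesis
    using lift_Suc_mono_le[of d 0 n] step by simp
qed

text \<open>Writing \<open>y n = C * cos (n * t + s)\<close> and \<open>x = 2 * cos t\<close>, some multiple of \<open>t\<close> brings the
  phase within \<open>t\<close> of a multiple of \<open>\<pi>\<close>, where \<open>\<bar>y n\<bar> \<ge> C * \<bar>x\<bar> / 2\<close>; moreover \<open>C\<^sup>2 \<ge> m\<close>. The proof
  detects this phase by a sign change of \<open>y (n + 2) - y n\<close>.\<close>

lemma recurrence_peak_nonneg:
  fixes y :: "nat \<Rightarrow> real"
  assumes rec: "\<And>n. y (Suc (Suc n)) = x * y (Suc n) - y n"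
    and bounded: "\<And>n. \<bar>y n\<bar> \<le> K" and x: "0 \<le> x" "x \<le> 2"
    and m: "x\<^sup>2 + (y 0)\<^sup>2 + (y 1)\<^sup>2 - x * y 0 * y 1 = m" and "m > 4"
  shows "\<exists>n. (y n)\<^sup>2 \<ge> m / 4 * x\<^sup>2"
proof (rule ccontr)
  assume "\<not> ?thesis"
  then have small: "(y n)\<^sup>2 < m / 4 * x\<^sup>2" for n
    by (simp add: not_le)
  \<comment> \<open>The conserved quantity of the recurrence, which ties each pair of consecutive
    terms to \<open>m\<close>.\<close>
  have D: "(y n)\<^sup>2 + (y (Suc n))\<^sup>2 - x * y n * y (Suc n) = m - x\<^sup>2" for n
  proof (induction n)
    case 0
    then show ?case using m by simp
  next
    case (Suc n)
    then show ?case unfolding rec by (simp add: power2_eq_square algebra_simps)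
  qed
  define d where "d n = y (Suc (Suc n)) - y n" for n
  have d_rec: "d (Suc (Suc n)) = x * d (Suc n) - d n" for n
    by (simp add: d_def rec algebra_simps)
  \<comment> \<open>The product is computed from the conserved quantity. Were it at most 0, then
    \<open>a * b \<ge> m / 4 * x\<^sup>2\<close> for the two middle terms, and the larger of their
    squares would violate \<open>small\<close>.\<close>
  have same_sign: "d n * d (Suc n) > 0" for n
  proof (rule ccontr)
    assume neg: "\<not> d n * d (Suc n) > 0"
    define a b where "a = y (Suc n)" and "b = y (Suc (Suc n))"
    have "y n = x * a - b"
      using rec[of n] by (simp add: a_def b_def)
    then have "d n = 2 * b - x * a" "d (Suc n) = x * b - 2 * a"
      using rec[of "Suc n"] by (simp_all add: d_def a_def b_def)
    then have "d n * d (Suc n) = (2 * b - x * a) * (x * b - 2 * a)"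
      by simp
    also have "\<dots> = 2 * x * (a\<^sup>2 + b\<^sup>2 - x * a * b) - (4 - x\<^sup>2) * (a * b)"
      by (simp add: power2_eq_square algebra_simps)
    also have "\<dots> = 2 * x * (m - x\<^sup>2) - (4 - x\<^sup>2) * (a * b)"
      using D[of "Suc n"] by (simp add: a_def b_def)
    finally have le: "2 * x * (m - x\<^sup>2) \<le> (4 - x\<^sup>2) * (a * b)"
      using neg by simp
    have x0: "x > 0"
      using small[of 0] x by (cases "x = 0") auto
    have "x \<noteq> 2"
      using le \<open>m > 4\<close> by auto
    have "x\<^sup>2 < 2\<^sup>2"
      using x \<open>x \<noteq> 2\<close> by (intro power_strict_mono) auto
    then have x4: "4 - x\<^sup>2 > 0"
      by simp
    have "(4 - x\<^sup>2) * m \<le> 4 * (m - x\<^sup>2)"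
      using \<open>m > 4\<close> mult_right_mono[of 4 m "x\<^sup>2"] by (simp add: algebra_simps)
    then have "(x / 2) * ((4 - x\<^sup>2) * m) \<le> (x / 2) * (4 * (m - x\<^sup>2))"
      using x0 by (intro mult_left_mono) auto
    also have "\<dots> \<le> (4 - x\<^sup>2) * (a * b)"
      using le by (simp add: algebra_simps)
    finally have "(4 - x\<^sup>2) * (x * m / 2) \<le> (4 - x\<^sup>2) * (a * b)"
      by (simp add: algebra_simps)
    then have "x * m / 2 \<le> a * b"
      using x4 by simp
    moreover have "x * (x * m) \<le> 2 * (x * m)"
      using x x0 \<open>m > 4\<close> by (intro mult_right_mono) auto
    ultimately have "m / 4 * x\<^sup>2 \<le> a * b"
      by (simp add: power2_eq_square algebra_simps)
    moreover have "2 * (a * b) \<le> a\<^sup>2 + b\<^sup>2"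
      using sum_squares_bound[of a b] by simp
    ultimately show False
      using small[of "Suc n"] small[of "Suc (Suc n)"] unfolding a_def b_def by linarith
  qed
  \<comment> \<open>By \<open>x \<le> 2\<close> the positive differences \<open>s * d n\<close> are
    concave, hence at least \<open>s * d 0\<close>. So \<open>s * y (2 * n)\<close> grows linearly,
    against \<open>bounded\<close>; the sign \<open>s\<close> covers increasing and decreasing
    sequences.\<close>
  have unbounded: False
    if pos: "\<And>n. s * d n > 0" and s: "\<bar>s\<bar> = 1" for s
  proof -
    have mono: "s * d 0 \<le> s * d n" for n
    proof (rule concave_pos_mono[OF pos])
      fix n
      have "s * d (Suc (Suc n)) = x * (s * d (Suc n)) - s * d n"
        by (simp add: d_rec algebra_simps)
      moreover have "x * (s * d (Suc n)) \<le> 2 * (s * d (Suc n))"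
        using x pos[of "Suc n"] by (intro mult_right_mono) auto
      ultimately show "s * d (Suc (Suc n)) - s * d (Suc n) \<le> s * d (Suc n) - s * d n"
        by linarith
    qed
    have step: "s * y (2 * n) + s * d 0 \<le> s * y (2 * Suc n)" for n
      using mono[of "2 * n"] by (simp add: d_def[of "2 * n"] right_diff_distrib le_diff_eq add.commute)
    have lower: "s * y 0 + real n * (s * d 0) \<le> s * y (2 * n)" for n
    proof (induction n)
      case (Suc n)
      then show ?case using step[of n] by (simp add: algebra_simps)
    qed simp
    obtain n where "2 * K < real n * (s * d 0)"
      using reals_Archimedean3[OF pos[of 0]] by blast
    moreover have "\<bar>s * y k\<bar> \<le> K" for k
      using bounded[of k] s by (simp add: abs_mult)
    ultimately show False
      using lower[of n] by (smt (verit))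
  qed
  show False
  proof (cases "d 0 > 0")
    case True
    have "d n > 0" for n
    proof (induction n)
      case (Suc n)
      then show ?case using same_sign[of n] by (simp add: zero_less_mult_iff)
    qed (rule True)
    then show False using unbounded[of 1] by simp
  next
    case False
    have "d n < 0" for n
    proof (induction n)
      case 0
      then show ?case using False same_sign[of 0] by (cases "d 0 = 0") auto
    next
      case (Suc n)
      then show ?case using same_sign[of n] by (simp add: zero_less_mult_iff)
    qed
    then show False using unbounded[of "-1"] by simp
  qed
qed

lemma recurrence_peak:
  fixes y :: "nat \<Rightarrow> real"
  assumes rec: "\<And>n. y (Suc (Suc n)) = x * y (Suc n) - y n"
    and bounded: "\<And>n. \<bar>y n\<bar> \<le> K" and x: "\<bar>x\<bar> \<le> 2"
    and m: "x\<^sup>2 + (y 0)\<^sup>2 + (y 1)\<^sup>2 - x * y 0 * y 1 = m" and "m > 4"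
  shows "\<exists>n. (y n)\<^sup>2 \<ge> m / 4 * x\<^sup>2"
proof (cases "x \<ge> 0")
  case True
  then show ?thesis
    using assms by (intro recurrence_peak_nonneg[of y x K]) auto
next
  case False
  \<comment> \<open>Alternating signs turn the recurrence for \<open>x\<close> into the one for
    \<open>- x\<close> and keep all squares.\<close>
  define z where "z n = (-1) ^ n * y n" for n
  have "\<exists>n. (z n)\<^sup>2 \<ge> m / 4 * (- x)\<^sup>2"
  proof (rule recurrence_peak_nonneg[of z "- x" K])
    show "\<bar>z n\<bar> \<le> K" for n
      using bounded[of n] by (simp add: z_def abs_mult power_abs)
  qed (use False x m \<open>m > 4\<close> in \<open>auto simp: z_def rec algebra_simps\<close>)
  moreover have "(z n)\<^sup>2 = (y n)\<^sup>2" for n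
    by (cases "even n") (auto simp: z_def)
  ultimately show ?thesis
    by simp
qed

subsection \<open>Values of a Markoff map\<close>

context markoff_map
begin

text \<open>For the traces of a representation this is the trace of the commutator plus 2, an
  invariant of the boundary curve.\<close>

definition vertex :: "int \<Rightarrow> int \<Rightarrow> int \<Rightarrow> int \<Rightarrow> complex" where
  "vertex a b c d = (f a b)\<^sup>2 + (f c d)\<^sup>2 + (f (a + c) (b + d))\<^sup>2 - f a b * f c d * f (a + c) (b + d)"

lemma diff_eq:
  assumes "\<bar>a * d - b * c\<bar> = 1"
  shows "f (a - c) (b - d) = f a b * f c d - f (a + c) (b + d)"
  using edge[OF assms] by (simp add: algebra_simps)

lemma neg_add_eq:
  assumes "\<bar>a * d - b * c\<bar> = 1"
  shows "f (- a + c) (- b + d) = f a b * f c d - f (a + c) (b + d)"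
  using diff_eq[OF assms] minus[of "a - c" "b - d"] by simp

lemma add_add_eq:
  assumes "\<bar>a * d - b * c\<bar> = 1"
  shows "f (a + c + c) (b + d + d) = f (a + c) (b + d) * f c d - f a b"
proof -
  have "\<bar>(a + c) * d - (b + d) * c\<bar> = 1"
    using assms by (simp add: algebra_simps)
  from edge[OF this] show ?thesis by (simp add: algebra_simps)
qed

text \<open>Each move permutes the three values or replaces one of them by the other root of the
  same quadratic equation, \<open>z\<close> by \<open>x * y - z\<close>.\<close>

lemma vertex_eq:
  assumes "\<bar>a * d - b * c\<bar> = 1" "\<bar>a0 * d0 - b0 * c0\<bar> = 1"
  shows "vertex a b c d = vertex a0 b0 c0 d0"
  using assms
proof (induction rule: unimodular_induct)
  case (swap a b c d)
  then show ?case by (simp add: vertex_def add.commute mult_ac)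
next
  case (neg a b c d)
  have "vertex (- a) (- b) c d = vertex a b c d"
    unfolding vertex_def neg_add_eq[OF neg.hyps(1)] minus by (simp add: power2_eq_square algebra_simps)
  then show ?case using neg by simp
next
  case (add a b c d)
  have "vertex (a + c) (b + d) c d = vertex a b c d"
    unfolding vertex_def add_add_eq[OF add.hyps(1)] by (simp add: power2_eq_square algebra_simps)
  then show ?case using add by simp
qed simp

text \<open>When two of three values are zero, passing to the other root keeps a zero or changes the
  sign of the remaining value.\<close>

lemma dihedral_values:
  assumes "\<bar>a * d - b * c\<bar> = 1" "\<bar>a0 * d0 - b0 * c0\<bar> = 1"
    and "f a0 b0 \<in> {0, t, - t}" "f c0 d0 \<in> {0, t, - t}" "f (a0 + c0) (b0 + d0) \<in> {0, t, - t}"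
    and "dihedral (f a0 b0, f c0 d0, f (a0 + c0) (b0 + d0))"
  shows "f a b \<in> {0, t, - t} \<and> f c d \<in> {0, t, - t} \<and> f (a + c) (b + d) \<in> {0, t, - t} \<and>
    dihedral (f a b, f c d, f (a + c) (b + d))"
  using assms(1,2)
proof (induction rule: unimodular_induct)
  case init
  then show ?case using assms(3-6) by blast
next
  case (swap a b c d)
  then show ?case by (auto simp: dihedral_def add.commute)
next
  case (neg a b c d)
  then show ?case
    unfolding neg_add_eq[OF neg.hyps(1)] minus by (auto simp: dihedral_def)
next
  case (add a b c d)
  then show ?case
    unfolding add_add_eq[OF add.hyps(1)] by (auto simp: dihedral_def)
qed

text \<open>By \<open>vertex_eq\<close> the bound \<open>m \<le> 4\<close> is available at every
  basis, so \<open>abs_flip_le_2\<close> keeps each new value in the range.\<close>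

lemma elliptic_range_values:
  assumes det: "\<bar>a * d - b * c\<bar> = 1" "\<bar>a0 * d0 - b0 * c0\<bar> = 1"
    and "f a0 b0 \<in> elliptic_range" "f c0 d0 \<in> elliptic_range" "f (a0 + c0) (b0 + d0) \<in> elliptic_range"
    and vertex: "vertex a0 b0 c0 d0 = of_real m" "m \<le> 4"
  shows "f a b \<in> elliptic_range \<and> f c d \<in> elliptic_range \<and> f (a + c) (b + d) \<in> elliptic_range"
proof -
  have flip: "f a b * f c d - f (a + c) (b + d) \<in> elliptic_range"
    if h: "\<bar>a * d - b * c\<bar> = 1" "f a b \<in> elliptic_range" "f c d \<in> elliptic_range"
      "f (a + c) (b + d) \<in> elliptic_range" for a b c d
  proof -
    obtain x y z where eq: "f a b = of_real x" "f c d = of_real y" "f (a + c) (b + d) = of_real z"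
      and le: "\<bar>x\<bar> \<le> 2" "\<bar>y\<bar> \<le> 2"
      using h unfolding elliptic_range_iff by blast
    have "of_real (x\<^sup>2 + y\<^sup>2 + z\<^sup>2 - x * y * z) = (of_real m :: complex)"
      using vertex(1) vertex_eq[OF h(1) det(2)] by (simp add: vertex_def eq)
    then have "x\<^sup>2 + y\<^sup>2 + z\<^sup>2 - x * y * z \<le> 4"
      using vertex(2) by (simp only: of_real_eq_iff)
    from abs_flip_le_2[OF le this] show ?thesis
      unfolding eq elliptic_range_iff by (metis of_real_diff of_real_mult)
  qed
  show ?thesis
    using det
  proof (induction rule: unimodular_induct)
    case init
    then show ?case using assms(3-5) by blast
  next
    case (swap a b c d)
    then show ?case by (simp add: add.commute)
  next
    case (neg a b c d)
    then show ?case
      unfolding neg_add_eq[OF neg.hyps(1)] minus using flip by blast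
  next
    case (add a b c d)
    have "f (a + c) (b + d) * f c d - f a b \<in> elliptic_range"
    proof -
      \<comment> \<open>The move \<open>add\<close> is a flip for the basis
        \<open>(- c, - d)\<close>, \<open>(a + c, b + d)\<close>, whose sum is
        \<open>(a, b)\<close>.\<close>
      have "\<bar>- c * (b + d) - - d * (a + c)\<bar> = 1"
        using add.hyps(1) by (simp add: algebra_simps abs_minus_commute)
      moreover have "f (- c) (- d) = f c d" "f (- c + (a + c)) (- d + (b + d)) = f a b"
        by (simp_all add: minus)
      ultimately show ?thesis
        using flip[of "- c" "b + d" "- d" "a + c"] add.IH by (simp add: mult.commute)
    qed
    then show ?case
      unfolding add_add_eq[OF add.hyps(1)] using add.IH by blast
  qed
qed

text \<open>The last hypothesis says that the value behind the edge does not exceed the larger one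
  on it. With both values at least 3, the edge relation makes the value at the sum at least their
  maximum, so both edges ahead satisfy the same hypotheses. The Euclidean algorithm on
  \<open>(m, n)\<close> then reaches every primitive vector of the cone.\<close>

lemma cone_growth:
  assumes "\<bar>a * d - b * c\<bar> = 1" "coprime m n" and "M \<ge> 3"
    and "norm (f a b) \<ge> M" "norm (f c d) \<ge> M"
    and "norm (f (a - c) (b - d)) \<le> max (norm (f a b)) (norm (f c d))"
  shows "norm (f (int m * a + int n * c) (int m * b + int n * d)) \<ge> M"
  using assms
proof (induction "m + n" arbitrary: a b c d m n rule: less_induct)
  case less
  have "norm (f a b) * norm (f c d) \<le> norm (f (a + c) (b + d)) + norm (f (a - c) (b - d))"
    using norm_triangle_ineq[of "f (a + c) (b + d)" "f (a - c) (b - d)"]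
    by (simp add: edge[OF less.prems(1)] norm_mult)
  moreover have "2 * max (norm (f a b)) (norm (f c d)) \<le>
      norm (f a b) * norm (f c d) - max (norm (f a b)) (norm (f c d))"
  proof -
    have "3 * norm (f c d) \<le> norm (f a b) * norm (f c d)" "norm (f a b) * 3 \<le> norm (f a b) * norm (f c d)"
      using less.prems(3-5) by (intro mult_right_mono mult_left_mono; simp)+
    then show ?thesis
      unfolding max_def by auto
  qed
  ultimately have new: "norm (f (a + c) (b + d)) \<ge> max (norm (f a b)) (norm (f c d))"
    using less.prems(3-6) by linarith
  then have newM: "norm (f (a + c) (b + d)) \<ge> M"
    using less.prems(4) by linarith
  consider "m = 0" | "n = 0" | "m > 0" "n \<le> m" "n > 0" | "m > 0" "m \<le> n"
    by linarith
  then show ?case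
  proof cases
    case 1
    then show ?thesis using less.prems by simp
  next
    case 2
    then show ?thesis using less.prems by simp
  next
    case 3
    then obtain k where k: "m = n + k"
      using le_Suc_ex by blast
    \<comment> \<open>Behind the new edge from \<open>(a, b)\<close> to the sum lies
      \<open>(c, d)\<close>.\<close>
    have "f (a - (a + c)) (b - (b + d)) = f c d"
      using minus[of c d] by simp
    moreover have "coprime k n"
      using less.prems(2) unfolding k by (metis add.commute coprime_iff_gcd_eq_1 gcd_add1)
    ultimately have "norm (f (int k * a + int n * (a + c)) (int k * b + int n * (b + d))) \<ge> M"
      using less.prems new newM 3 k
      by (intro less.hyps) (auto simp: algebra_simps)
    then show ?thesis
      by (simp add: k algebra_simps)
  next
    case 4
    then obtain k where k: "n = m + k"
      using le_Suc_ex by blast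
    have "f (a + c - c) (b + d - d) = f a b"
      by simp
    moreover have "coprime m k"
      using less.prems(2) unfolding k by (metis coprime_iff_gcd_eq_1 gcd_add2)
    ultimately have "norm (f (int m * (a + c) + int k * c) (int m * (b + d) + int k * d)) \<ge> M"
      using less.prems new newM 4 k
      by (intro less.hyps) (auto simp: algebra_simps)
    then show ?thesis
      by (simp add: k algebra_simps)
  qed
qed

lemma neighbour_rec:
  assumes "\<bar>a * d - b * c\<bar> = 1"
  shows "f (c + (k + 1) * a) (d + (k + 1) * b) + f (c + (k - 1) * a) (d + (k - 1) * b) =
    f a b * f (c + k * a) (d + k * b)"
proof -
  have "\<bar>(c + k * a) * b - (d + k * b) * a\<bar> = 1"
    using assms by (simp add: algebra_simps abs_minus_commute)
  from edge[OF this] show ?thesis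
    by (simp add: algebra_simps)
qed

lemma neighbour_dichotomy:
  assumes det: "\<bar>a * d - b * c\<bar> = 1" and l: "norm l > 1" "l + inverse l = f a b"
  shows "(\<forall>n. f (c + int n * a) (d + int n * b) = inverse l ^ n * f c d) \<or>
    filterlim (\<lambda>n. norm (f (c + int n * a) (d + int n * b))) at_top sequentially"
proof -
  have "f (c + int (Suc (Suc n)) * a) (d + int (Suc (Suc n)) * b) =
      (l + inverse l) * f (c + int (Suc n) * a) (d + int (Suc n) * b) - f (c + int n * a) (d + int n * b)" for n
    using neighbour_rec[OF det, of "int (Suc n)"] unfolding l(2) by (simp add: algebra_simps)
  from recurrence_dichotomy[where y = "\<lambda>n. f (c + int n * a) (d + int n * b)", OF l(1) this] show ?thesis
    by simp
qed

end

subsection \<open>Slopes and the growth criterion\<close>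

text \<open>The direction b + i a of slope a / b before normalisation; its square scaled to norm one
  is \<open>slope_point\<close>.\<close>

definition slope_vec :: "int \<Rightarrow> int \<Rightarrow> complex" where
  "slope_vec a b = Complex (of_int b) (of_int a)"

lemma slope_vec_eq_0_iff [simp]: "slope_vec a b = 0 \<longleftrightarrow> a = 0 \<and> b = 0"
  by (auto simp: slope_vec_def complex_eq_iff)

lemma slope_vec_comb:
  "slope_vec (s * a + t * c) (s * b + t * d) = of_int s * slope_vec a b + of_int t * slope_vec c d"
  by (simp add: slope_vec_def complex_eq_iff)

lemma slope_point_eq: "slope_point (a, b) = slope_vec a b / cnj (slope_vec a b)"
proof (cases "slope_vec a b = 0")
  case True
  then show ?thesis by (simp add: slope_point_def)
next
  case False
  have "slope_vec a b = of_int b + \<i> * of_int a"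
    by (simp add: slope_vec_def complex_eq_iff)
  moreover have "of_real (real_of_int b ^ 2 + real_of_int a ^ 2) = slope_vec a b * cnj (slope_vec a b)"
    by (simp add: slope_vec_def complex_eq_iff power2_eq_square)
  ultimately have "slope_point (a, b) = (slope_vec a b)\<^sup>2 / (slope_vec a b * cnj (slope_vec a b))"
    by (simp add: slope_point_def)
  then show ?thesis
    using False by (simp add: power2_eq_square)
qed

lemma slope_point_in_PL: "a \<noteq> 0 \<or> b \<noteq> 0 \<Longrightarrow> slope_point (a, b) \<in> PL"
  by (auto simp: PL_def slope_point_eq norm_divide)

lemma slope_point_minus [simp]: "slope_point (- a, - b) = slope_point (a, b)"
  by (simp add: slope_point_def power2_eq_square algebra_simps)

text \<open>Squaring doubles angles, so the chord is twice the sine of the angle between the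
  vectors, and that sine is the determinant over the product of the lengths, up to sign.\<close>

lemma dist_slope_point:
  assumes "a \<noteq> 0 \<or> b \<noteq> 0" "c \<noteq> 0 \<or> d \<noteq> 0"
  shows "dist (slope_point (a, b)) (slope_point (c, d)) =
    2 * \<bar>of_int (a * d - b * c)\<bar> / (norm (slope_vec a b) * norm (slope_vec c d))"
proof -
  define h k where "h = slope_vec a b" and "k = slope_vec c d"
  define m where "m = a * d - b * c"
  have nz: "h \<noteq> 0" "k \<noteq> 0"
    using assms by (simp_all add: h_def k_def)
  have "h / cnj h - k / cnj k = (h * cnj k - k * cnj h) / (cnj h * cnj k)"
    using nz by (simp add: field_simps)
  also have "h * cnj k - k * cnj h = 2 * \<i> * of_real (of_int m)"
    by (simp add: m_def h_def k_def slope_vec_def complex_eq_iff algebra_simps)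
  finally show ?thesis
    unfolding dist_norm slope_point_eq h_def[symmetric] k_def[symmetric] m_def[symmetric]
    by (simp add: norm_divide norm_mult)
qed

lemma slope_point_comb_tendsto:
  assumes "a \<noteq> 0 \<or> b \<noteq> 0"
  shows "(\<lambda>n. slope_point (c + int n * a, d + int n * b)) \<longlonglongrightarrow> slope_point (a, b)"
proof -
  define z where "z n = slope_vec a b + slope_vec c d / of_nat n" for n :: nat
  have z: "z \<longlonglongrightarrow> slope_vec a b"
    unfolding z_def using tendsto_add[OF tendsto_const lim_const_over_n, of "slope_vec a b" "slope_vec c d"] by simp
  have "(\<lambda>n. z n / cnj (z n)) \<longlonglongrightarrow> slope_point (a, b)"
    unfolding slope_point_eq using assms z by (intro tendsto_divide tendsto_cnj) auto
  moreover have "slope_point (c + int n * a, d + int n * b) = z n / cnj (z n)" if "n > 0" for n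
  proof -
    have "slope_vec (c + int n * a) (d + int n * b) = of_real (real n) * z n"
      using slope_vec_comb[of 1 c "int n" a d b] that by (simp add: z_def field_simps)
    then show ?thesis
      using that by (simp add: slope_point_eq)
  qed
  then have "\<forall>\<^sub>F n in sequentially. z n / cnj (z n) = slope_point (c + int n * a, d + int n * b)"
    by (intro eventually_sequentiallyI[of 1]) auto
  ultimately show ?thesis
    by (rule Lim_transform_eventually)
qed

lemma floor_mult_div_tendsto: "(\<lambda>n. of_int \<lfloor>real n * x\<rfloor> / real n) \<longlonglongrightarrow> x"
proof -
  have "(\<lambda>n. of_int \<lfloor>real n * x\<rfloor> / real n - x) \<longlonglongrightarrow> 0"
  proof (rule Lim_null_comparison)
    show "(\<lambda>n. 1 / real n) \<longlonglongrightarrow> 0"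
      by (rule lim_const_over_n)
    have "norm (of_int \<lfloor>real n * x\<rfloor> / real n - x) \<le> 1 / real n" if "n > 0" for n
    proof -
      have "of_int \<lfloor>real n * x\<rfloor> / real n - x = (of_int \<lfloor>real n * x\<rfloor> - real n * x) / real n"
        using that by (simp add: field_simps)
      moreover have "\<bar>of_int \<lfloor>real n * x\<rfloor> - real n * x\<bar> \<le> 1"
        by linarith
      ultimately show ?thesis
        using that by (simp add: divide_right_mono)
    qed
    then show "\<forall>\<^sub>F n in sequentially. norm (of_int \<lfloor>real n * x\<rfloor> / real n - x) \<le> 1 / real n"
      by (intro eventually_sequentiallyI[of 1]) auto
  qed
  then show ?thesis
    by (simp add: LIM_zero_iff)
qed

text \<open>A square root \<open>h\<close> of \<open>L\<close> is a direction with slope point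
  \<open>L\<close>. Rounding the multiples of \<open>h\<close> to lattice vectors approximates it,
  and division by the gcd makes the vector primitive.\<close>

lemma slope_points_dense:
  assumes "L \<in> PL" "open U" "L \<in> U"
  obtains a b where "coprime a b" "slope_point (a, b) \<in> U"
proof -
  define h where "h = csqrt L"
  have hL: "h\<^sup>2 = L"
    by (simp add: h_def)
  have "(norm h)\<^sup>2 = 1"
    using assms(1) hL by (metis PL_def mem_sphere_0 norm_power)
  then have "h * cnj h = 1"
    by (simp add: complex_norm_square[symmetric])
  moreover from this have h0: "h \<noteq> 0"
    by auto
  moreover have "h / cnj h = h\<^sup>2 / (h * cnj h)"
    using h0 by (simp add: power2_eq_square)
  ultimately have h: "h / cnj h = L" "h \<noteq> 0"
    by (simp_all add: hL)
  define p q where "p n = \<lfloor>real n * Im h\<rfloor>" and "q n = \<lfloor>real n * Re h\<rfloor>" for n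
  define z where "z n = Complex (of_int (q n) / real n) (of_int (p n) / real n)" for n
  have z: "z \<longlonglongrightarrow> h"
    using tendsto_Complex[OF floor_mult_div_tendsto[of "Re h"] floor_mult_div_tendsto[of "Im h"]]
    by (simp add: z_def[abs_def] p_def q_def)
  have "(\<lambda>n. z n / cnj (z n)) \<longlonglongrightarrow> L"
    unfolding h(1)[symmetric] using z h(2) by (intro tendsto_divide tendsto_cnj) auto
  then have "\<forall>\<^sub>F n in sequentially. z n / cnj (z n) \<in> U"
    using assms(2,3) by (rule topological_tendstoD)
  moreover have "\<forall>\<^sub>F n in sequentially. z n \<noteq> 0"
    using z h(2) by (rule tendsto_imp_eventually_ne)
  ultimately have "\<forall>\<^sub>F n in sequentially. z n / cnj (z n) \<in> U \<and> z n \<noteq> 0 \<and> n > 0"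
    using eventually_gt_at_top[of 0] by eventually_elim auto
  then obtain n where n: "z n / cnj (z n) \<in> U" "z n \<noteq> 0" "n > 0"
    using eventually_happens'[OF sequentially_bot] by blast
  define g where "g = gcd (p n) (q n)"
  have "slope_vec (p n) (q n) = of_real (real n) * z n"
    using n(3) by (simp add: slope_vec_def z_def complex_eq_iff)
  then have sp: "slope_point (p n, q n) \<in> U" and nz: "slope_vec (p n) (q n) \<noteq> 0"
    using n by (simp_all add: slope_point_eq)
  then have g: "g \<noteq> 0"
    by (simp add: g_def)
  have eq: "p n = g * (p n div g)" "q n = g * (q n div g)"
    by (simp_all add: g_def)
  have "coprime (p n div g) (q n div g)"
    unfolding g_def using nz by (intro div_gcd_coprime) auto
  moreover have "slope_vec (p n) (q n) = of_real (of_int g) * slope_vec (p n div g) (q n div g)"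
    using slope_vec_comb[of g "p n div g" 0 0 "q n div g" 0] eq by simp
  then have "slope_point (p n div g, q n div g) = slope_point (p n, q n)"
    using g by (simp add: slope_point_eq)
  ultimately show thesis
    using sp that by metis
qed

lemma coprime_extend:
  fixes a b :: int
  assumes "coprime a b"
  obtains c d where "\<bar>a * d - b * c\<bar> = 1"
proof -
  obtain u v where "u * a + v * b = gcd a b"
    using bezout_int by blast
  then have "u * a + v * b = 1"
    using assms by simp
  then have "\<bar>a * u - b * - v\<bar> = 1"
    by (simp add: algebra_simps)
  then show thesis by (rule that)
qed

section \<open>Growth of neighbours and isolation from bounded values\<close>

context markoff_map
begin

definition ends :: "complex set" where
  "ends = {L \<in> PL. \<exists>K>0. \<exists>Xs :: nat \<Rightarrow> int \<times> int.
      (\<forall>n. Xs n \<in> curves) \<and> inj Xs \<and> (\<lambda>n. slope_point (Xs n)) \<longlonglongrightarrow> L \<and>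
      (\<forall>n. norm (f (fst (Xs n)) (snd (Xs n))) < K)}"

text \<open>For \<open>s > 0\<close> the vector lies in the cone over the consecutive neighbours of
  \<open>(a, b)\<close> with indices \<open>t div s\<close> and \<open>t div s + 1\<close>. Behind
  that edge lies \<open>(a, b)\<close>, so \<open>cone_growth\<close> applies once both neighbours
  are large.\<close>

lemma growth_far_from_vertex:
  assumes det: "\<bar>a * d - b * c\<bar> = 1"
    and M: "M \<ge> 3" "M \<ge> norm (f a b)"
    and large: "\<And>k. \<bar>k\<bar> \<ge> N \<Longrightarrow> norm (f (c + k * a) (d + k * b)) \<ge> M"
    and cop: "coprime s t" and s: "s \<noteq> 0" and t: "\<bar>t\<bar> \<ge> (N + 1) * \<bar>s\<bar>" and "N \<ge> 0"
  shows "norm (f (s * c + t * a) (s * d + t * b)) \<ge> M"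
proof -
  have pos: "norm (f (s * c + t * a) (s * d + t * b)) \<ge> M"
    if s: "s > 0" and t: "\<bar>t\<bar> \<ge> (N + 1) * s" and cop: "coprime s t" for s t :: int
  proof -
    define n r where "n = t div s" and "r = t mod s"
    have tn: "t = n * s + r"
      unfolding n_def r_def by (rule div_mult_mod_eq[symmetric])
    have r: "0 \<le> r" "r < s"
      using s by (simp_all add: r_def)
    \<comment> \<open>The factor \<open>N + 1\<close> in the hypothesis is for negative
      \<open>t\<close>: there \<open>n \<le> - (N + 1)\<close>, and the index \<open>n + 1\<close>
      still has size at least \<open>N\<close>.\<close>
    have "N \<le> \<bar>n\<bar> \<and> N \<le> \<bar>n + 1\<bar>"
    proof (cases "t \<ge> 0")
      case True
      then have "(N + 1) * s div s \<le> n"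
        unfolding n_def using s t by (intro zdiv_mono1) auto
      then show ?thesis using s \<open>N \<ge> 0\<close> by simp
    next
      case False
      then have "n \<le> (- (N + 1) * s) div s"
        unfolding n_def using s t by (intro zdiv_mono1) (auto simp: algebra_simps)
      then have "n \<le> - (N + 1)"
        using s nonzero_mult_div_cancel_right[of s "- (N + 1)"] by simp
      then show ?thesis using \<open>N \<ge> 0\<close> by simp
    qed
    then have l: "norm (f (c + n * a) (d + n * b)) \<ge> M" "norm (f (c + (n + 1) * a) (d + (n + 1) * b)) \<ge> M"
      using large by blast+
    have "norm (f (int (nat (s - r)) * (c + n * a) + int (nat r) * (c + (n + 1) * a))
        (int (nat (s - r)) * (d + n * b) + int (nat r) * (d + (n + 1) * b))) \<ge> M"
    proof (rule cone_growth[OF _ _ M(1) l])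
      show "\<bar>(c + n * a) * (d + (n + 1) * b) - (d + n * b) * (c + (n + 1) * a)\<bar> = 1"
        using det by (simp add: algebra_simps abs_minus_commute)
      have "coprime s r"
        using cop unfolding tn by (simp add: coprime_iff_gcd_eq_1 gcd_add_mult)
      then have "coprime (s - r) r"
        by (simp add: coprime_iff_gcd_eq_1 gcd_diff1)
      then have "coprime (int (nat (s - r))) (int (nat r))"
        using r by simp
      then show "coprime (nat (s - r)) (nat r)"
        by (simp only: coprime_int_iff)
      have diff: "f (c + n * a - (c + (n + 1) * a)) (d + n * b - (d + (n + 1) * b)) = f a b"
        using minus[of a b] by (simp add: algebra_simps)
      show "norm (f (c + n * a - (c + (n + 1) * a)) (d + n * b - (d + (n + 1) * b)))
          \<le> max (norm (f (c + n * a) (d + n * b))) (norm (f (c + (n + 1) * a) (d + (n + 1) * b)))"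
        unfolding diff using M(2) l(1) by (intro order_trans[OF _ max.cobounded1]) linarith
    qed
    moreover have "int (nat (s - r)) * (c + n * a) + int (nat r) * (c + (n + 1) * a) = s * c + t * a"
      "int (nat (s - r)) * (d + n * b) + int (nat r) * (d + (n + 1) * b) = s * d + t * b"
      using r by (simp_all add: tn algebra_simps)
    ultimately show ?thesis by simp
  qed
  show ?thesis
  proof (cases "s > 0")
    case True
    then show ?thesis using pos t cop by simp
  next
    case False
    then have "norm (f (- s * c + - t * a) (- s * d + - t * b)) \<ge> M"
      using s t cop by (intro pos) auto
    then show ?thesis
      using minus[of "s * c + t * a" "s * d + t * b"] by simp
  qed
qed

text \<open>A bounded value at \<open>s * (c, d) + t * (a, b)\<close> with
  \<open>s \<noteq> 0\<close> forces \<open>\<bar>t\<bar> < (N + 1) * \<bar>s\<bar>\<close>. Such a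
  vector has length at most a constant times \<open>\<bar>s\<bar>\<close>, which is its determinant
  with \<open>(a, b)\<close>, so its slope keeps a fixed distance by
  \<open>dist_slope_point\<close>.\<close>

lemma not_end_if_growth:
  assumes det: "\<bar>a * d - b * c\<bar> = 1"
    and growth: "\<And>M. \<exists>N. \<forall>k. \<bar>k\<bar> \<ge> N \<longrightarrow> norm (f (c + k * a) (d + k * b)) \<ge> M"
  shows "slope_point (a, b) \<notin> ends"
proof
  assume "slope_point (a, b) \<in> ends"
  then obtain K and Xs :: "nat \<Rightarrow> int \<times> int" where Xs: "\<And>n. Xs n \<in> curves" "inj Xs"
      "(\<lambda>n. slope_point (Xs n)) \<longlonglongrightarrow> slope_point (a, b)"
    and K: "\<And>n. norm (f (fst (Xs n)) (snd (Xs n))) < K"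
    unfolding ends_def by blast
  define M where "M = max 3 (max K (norm (f a b)))"
  obtain N0 where N0: "\<And>k. \<bar>k\<bar> \<ge> N0 \<Longrightarrow> norm (f (c + k * a) (d + k * b)) \<ge> M"
    using growth by blast
  define N where "N = \<bar>N0\<bar>"
  have N: "norm (f (c + k * a) (d + k * b)) \<ge> M" if "\<bar>k\<bar> \<ge> N" for k
    using N0[of k] that by (simp add: N_def)
  define e where "e = a * d - b * c"
  have ee: "e * e = 1"
    using det unfolding e_def[symmetric] by (metis abs_mult_self_eq mult_1)
  have nz: "a \<noteq> 0 \<or> b \<noteq> 0"
    using det by auto
  define R where "R = (norm (slope_vec c d) + of_int (N + 1) * norm (slope_vec a b)) * norm (slope_vec a b)"
  have "norm (slope_vec a b) > 0"
    using nz by auto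
  then have "R > 0"
    by (auto simp: R_def N_def intro!: mult_pos_pos add_nonneg_pos)
  have far: "dist (slope_point (Xs i)) (slope_point (a, b)) \<ge> 2 / R"
    if i: "Xs i \<notin> {(a, b), (- a, - b)}" for i
  proof -
    obtain p q where pq: "Xs i = (p, q)" by fastforce
    define s t where "s = e * (a * q - b * p)" and "t = e * (p * d - q * c)"
    have "s * c + t * a = e * e * p" "s * d + t * b = e * e * q"
      unfolding s_def t_def e_def by (simp_all add: algebra_simps)
    then have eq: "p = s * c + t * a" "q = s * d + t * b"
      by (simp_all add: ee)
    have pq_cop: "coprime p q"
      using Xs(1)[of i] unfolding pq by (simp add: curves_def)
    have cop: "coprime s t"
    proof (rule coprimeI)
      fix k assume "k dvd s" "k dvd t"
      then have "k dvd p" "k dvd q"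
        unfolding eq by simp_all
      then show "k dvd 1"
        using pq_cop by (rule coprime_common_divisor[rotated])
    qed
    have s0: "s \<noteq> 0"
    proof
      assume "s = 0"
      then have "\<bar>t\<bar> = 1"
        using cop by simp
      then have "t = 1 \<or> t = -1" by linarith
      then show False
        using i \<open>s = 0\<close> unfolding pq eq by auto
    qed
    have "\<not> \<bar>t\<bar> \<ge> (N + 1) * \<bar>s\<bar>"
    proof
      assume "\<bar>t\<bar> \<ge> (N + 1) * \<bar>s\<bar>"
      from growth_far_from_vertex[OF det _ _ N cop s0 this]
      have "norm (f p q) \<ge> M"
        by (simp add: M_def N_def eq)
      then show False
        using K[of i] by (simp add: pq M_def)
    qed
    then have "real_of_int \<bar>t\<bar> \<le> of_int ((N + 1) * \<bar>s\<bar>)"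
      by (simp only: of_int_le_iff)
    then have t: "\<bar>real_of_int t\<bar> \<le> of_int (N + 1) * \<bar>of_int s\<bar>"
      by (simp only: of_int_abs of_int_mult)
    have "slope_vec p q = of_int s * slope_vec c d + of_int t * slope_vec a b"
      unfolding eq by (rule slope_vec_comb)
    then have "norm (slope_vec p q) \<le> \<bar>of_int s\<bar> * norm (slope_vec c d) + \<bar>of_int t\<bar> * norm (slope_vec a b)"
      using norm_triangle_ineq[of "of_int s * slope_vec c d" "of_int t * slope_vec a b"]
      by (simp add: norm_mult)
    also have "\<dots> \<le> \<bar>of_int s\<bar> * norm (slope_vec c d) + of_int (N + 1) * \<bar>of_int s\<bar> * norm (slope_vec a b)"
      using t by (intro add_left_mono mult_right_mono) auto
    finally have "norm (slope_vec p q) * norm (slope_vec a b) \<le> (\<bar>of_int s\<bar> * norm (slope_vec c d) +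
        of_int (N + 1) * \<bar>of_int s\<bar> * norm (slope_vec a b)) * norm (slope_vec a b)"
      by (rule mult_right_mono) simp
    then have "norm (slope_vec p q) * norm (slope_vec a b) \<le> \<bar>of_int s\<bar> * R"
      by (simp add: R_def algebra_simps)
    moreover have "norm (slope_vec p q) * norm (slope_vec a b) > 0"
      using pq_cop nz by (intro mult_pos_pos) auto
    moreover have "\<bar>p * b - q * a\<bar> = \<bar>s\<bar>"
    proof -
      have "\<bar>e\<bar> = 1" using det by (simp add: e_def)
      then show ?thesis by (simp add: s_def abs_mult mult.commute abs_minus_commute)
    qed
    then have abs_s: "\<bar>real_of_int (p * b - q * a)\<bar> = \<bar>of_int s\<bar>"
      by (simp only: of_int_abs[symmetric])
    have "p \<noteq> 0 \<or> q \<noteq> 0"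
      using pq_cop by auto
    then have "dist (slope_point (Xs i)) (slope_point (a, b)) =
        2 * \<bar>of_int s\<bar> / (norm (slope_vec p q) * norm (slope_vec a b))"
      unfolding pq by (simp only: dist_slope_point[OF _ nz] abs_s)
    ultimately show ?thesis
      using \<open>R > 0\<close> s0 by (simp add: field_simps)
  qed
  have "finite (Xs -` {(a, b), (- a, - b)})"
    using Xs(2) by (intro finite_vimageI) auto
  then have "\<forall>\<^sub>F i in sequentially. Xs i \<notin> {(a, b), (- a, - b)}"
    unfolding cofinite_eq_sequentially[symmetric] eventually_cofinite by (simp add: vimage_def)
  moreover have "\<forall>\<^sub>F i in sequentially. dist (slope_point (Xs i)) (slope_point (a, b)) < 2 / R"
    using Xs(3) \<open>R > 0\<close> by (intro tendstoD) auto
  ultimately have "\<forall>\<^sub>F i in sequentially. False"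
    by eventually_elim (use far in force)
  then show False by simp
qed

end

subsection \<open>Open sets of end invariants\<close>

lemma elliptic_range_norm_le: "x \<in> elliptic_range \<Longrightarrow> norm x \<le> 2"
  by (auto simp: elliptic_range_iff)

text \<open>Each term is chosen strictly nearer to \<open>x\<close> than the one before, which makes
  the sequence injective.\<close>

lemma islimpt_imp_inj_sequence:
  fixes x :: "'a :: metric_space"
  assumes "x islimpt S"
  obtains g :: "nat \<Rightarrow> 'a" where "\<And>n. g n \<in> S - {x}" "inj g" "g \<longlonglongrightarrow> x"
proof -
  have ex: "\<exists>y. y \<in> S - {x} \<and> dist y x < e" if "e > 0" for e
    using assms that unfolding islimpt_approachable by blast
  have "\<exists>g. \<forall>n. (g n \<in> S - {x} \<and> dist (g n) x < 1 / real (Suc n)) \<and> dist (g (Suc n)) x < dist (g n) x"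
  proof (rule dependent_nat_choice)
    show "\<exists>y. y \<in> S - {x} \<and> dist y x < 1 / real (Suc 0)"
      by (rule ex) simp
    fix y n assume "y \<in> S - {x} \<and> dist y x < 1 / real (Suc n)"
    then have "min (dist y x) (1 / real (Suc (Suc n))) > 0"
      by auto
    from ex[OF this] show "\<exists>z. (z \<in> S - {x} \<and> dist z x < 1 / real (Suc (Suc n))) \<and> dist z x < dist y x"
      by auto
  qed
  then obtain g where g: "\<And>n. g n \<in> S - {x}" "\<And>n. dist (g n) x < 1 / real (Suc n)"
      "\<And>n. dist (g (Suc n)) x < dist (g n) x"
    by blast
  have "dist (g n) x < dist (g m) x" if "m < n" for m n
    using lift_Suc_mono_less[of "\<lambda>n. - dist (g n) x" m n] g(3) that by simp
  then have "inj g"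
    by (metis injI less_irrefl linorder_neqE_nat)
  moreover have "g \<longlonglongrightarrow> x"
  proof (rule metric_tendsto_imp_tendsto[OF LIMSEQ_inverse_real_of_nat])
    show "\<forall>\<^sub>F n in sequentially. dist (g n) x \<le> dist (inverse (real (Suc n))) 0"
      using g(2) by (intro always_eventually allI) (simp add: dist_real_def inverse_eq_divide less_imp_le)
  qed
  ultimately show thesis
    using that g(1) by blast
qed

context markoff_map
begin

lemma int_growth:
  assumes "filterlim (\<lambda>n. norm (f (c + int n * a) (d + int n * b))) at_top sequentially"
    and "filterlim (\<lambda>n. norm (f (- c + int n * a) (- d + int n * b))) at_top sequentially"
  shows "\<exists>N. \<forall>k. \<bar>k\<bar> \<ge> N \<longrightarrow> norm (f (c + k * a) (d + k * b)) \<ge> M"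
proof -
  obtain N1 where N1: "\<And>n. n \<ge> N1 \<Longrightarrow> M \<le> norm (f (c + int n * a) (d + int n * b))"
    using assms(1) unfolding filterlim_at_top eventually_sequentially by blast
  obtain N2 where N2: "\<And>n. n \<ge> N2 \<Longrightarrow> M \<le> norm (f (- c + int n * a) (- d + int n * b))"
    using assms(2) unfolding filterlim_at_top eventually_sequentially by blast
  have "norm (f (c + k * a) (d + k * b)) \<ge> M" if k: "\<bar>k\<bar> \<ge> int (max N1 N2)" for k
  proof (cases "k \<ge> 0")
    case True
    then have "nat k \<ge> N1"
      using k by linarith
    from N1[OF this] True show ?thesis by simp
  next
    case False
    then have "nat (- k) \<ge> N2"
      using k by linarith
    from N2[OF this] False have "M \<le> norm (f (- (c + k * a)) (- (d + k * b)))"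
      by (simp add: algebra_simps)
    then show ?thesis by (simp only: minus)
  qed
  then show ?thesis by blast
qed

text \<open>Growth on both sides would contradict \<open>not_end_if_growth\<close>, and by
  \<open>neighbour_dichotomy\<close> the alternative to growth is geometric decay.\<close>

lemma decaying_side:
  assumes det: "\<bar>a * d - b * c\<bar> = 1" and "slope_point (a, b) \<in> ends"
    and l: "norm l > 1" "l + inverse l = f a b"
  shows "(\<forall>n. f (c + int n * a) (d + int n * b) = inverse l ^ n * f c d) \<or>
    (\<forall>n. f (- c + int n * a) (- d + int n * b) = inverse l ^ n * f c d)"
proof (rule ccontr)
  assume no: "\<not> ?thesis"
  have "\<bar>a * - d - b * - c\<bar> = 1"
    using det by simp
  then have "filterlim (\<lambda>n. norm (f (- c + int n * a) (- d + int n * b))) at_top sequentially"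
    using neighbour_dichotomy[of a "- d" b "- c" l] l no by (simp only: minus) blast
  moreover have "filterlim (\<lambda>n. norm (f (c + int n * a) (d + int n * b))) at_top sequentially"
    using neighbour_dichotomy[OF det l] no by blast
  ultimately show False
    using not_end_if_growth[OF det int_growth] assms(2) by blast
qed

lemma inverse_power_tendsto_0:
  fixes l z :: complex
  assumes "norm l > 1"
  shows "(\<lambda>n. inverse l ^ n * z) \<longlonglongrightarrow> 0"
proof -
  have "norm (inverse l) < 1"
    using assms by (simp add: norm_inverse inverse_less_1_iff)
  then have "(\<lambda>n. inverse l ^ n) \<longlonglongrightarrow> 0"
    by (rule LIMSEQ_power_zero)
  then show ?thesis
    using tendsto_mult_left_zero by blast
qed

lemma not_decaying:
  assumes "norm l > 1" and ge: "\<And>n. n > 0 \<Longrightarrow> norm (g n) \<ge> 3"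
    and "\<forall>n. g n = inverse l ^ n * (z :: complex)"
  shows False
proof -
  have "g = (\<lambda>n. inverse l ^ n * z)"
    using assms(3) by (intro ext) simp
  then have "g \<longlonglongrightarrow> 0"
    using inverse_power_tendsto_0[OF assms(1), of z] by (simp only:)
  then obtain N where "\<And>n. n \<ge> N \<Longrightarrow> dist (g n) 0 < 3"
    using metric_LIMSEQ_D[of g 0 3] by auto
  from this[of "Suc N"] show False
    using ge[of "Suc N"] by simp
qed

text \<open>If the value at \<open>(a, b)\<close> is not elliptic, then the neighbours decay on one side of \<open>(a, b)\<close> and
  grow on the other. A neighbour far out on the growing side is surrounded by large values.\<close>

lemma elliptic_on_open_set_of_ends:
  assumes U: "open U" and ends: "\<And>a b. coprime a b \<Longrightarrow> slope_point (a, b) \<in> U \<Longrightarrow> slope_point (a, b) \<in> ends"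
    and nondihedral: "\<And>a b c d. \<bar>a * d - b * c\<bar> = 1 \<Longrightarrow> f a b \<noteq> 0 \<or> f c d \<noteq> 0"
    and ab: "coprime a b" "slope_point (a, b) \<in> U"
  shows "f a b \<in> elliptic_range"
proof (rule ccontr)
  assume "f a b \<notin> elliptic_range"
  then obtain l where l: "norm l > 1" "l + inverse l = f a b"
    by (rule exists_eigenvalue_norm_gt_1)
  obtain c0 d0 where det0: "\<bar>a * d0 - b * c0\<bar> = 1"
    using coprime_extend[OF ab(1)] .
  \<comment> \<open>The sign of \<open>(c0, d0)\<close> is chosen so that the decay takes place on
    the negative side.\<close>
  obtain c d where det: "\<bar>a * d - b * c\<bar> = 1"
    and decay: "\<forall>n. f (- c + int n * a) (- d + int n * b) = inverse l ^ n * f c d"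
  proof -
    have "\<bar>a * - d0 - b * - c0\<bar> = 1"
      using det0 by simp
    moreover have "f (- c0) (- d0) = f c0 d0"
      by (rule minus)
    ultimately show thesis
      using decaying_side[OF det0 ends[OF ab] l]
    proof (elim disjE)
      assume "\<forall>n. f (c0 + int n * a) (d0 + int n * b) = inverse l ^ n * f c0 d0"
      then show thesis
        by (intro that[OF \<open>\<bar>a * - d0 - b * - c0\<bar> = 1\<close>]) (simp add: minus)
    qed (rule that[OF det0])
  qed
  \<comment> \<open>Decay on both sides would give
    \<open>2 * inverse l * f c d = (l + inverse l) * f c d\<close>, hence zeros at
    \<open>(c, d)\<close> and \<open>(c + a, d + b)\<close>, which form a basis.\<close>
  have "\<not> (\<forall>n. f (c + int n * a) (d + int n * b) = inverse l ^ n * f c d)"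
  proof
    assume "\<forall>n. f (c + int n * a) (d + int n * b) = inverse l ^ n * f c d"
    from spec[OF this, of 1] have "f (c + a) (d + b) = inverse l * f c d"
      by simp
    moreover have "f (- c + a) (- d + b) = inverse l * f c d"
      using spec[OF decay, of 1] by simp
    moreover have "f (c - a) (d - b) = f (- c + a) (- d + b)"
      using minus[of "c - a" "d - b"] by simp
    ultimately have "inverse l * f c d + inverse l * f c d = (l + inverse l) * f c d"
      using neighbour_rec[OF det, of 0] by (simp add: l(2))
    then have eq: "(inverse l - l) * f c d = 0"
      by (simp add: algebra_simps)
    have "norm (inverse l) < norm l"
      using l(1) less_trans[of "inverse (norm l)" 1 "norm l"] by (simp add: norm_inverse inverse_less_1_iff)
    then have "inverse l - l \<noteq> 0"
      by auto
    then have "f c d = 0"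
      using eq by simp
    moreover have "f (c + a) (d + b) = 0"
      using \<open>f (c + a) (d + b) = inverse l * f c d\<close> calculation by simp
    moreover have "\<bar>c * (d + b) - d * (c + a)\<bar> = 1"
      using det by (simp add: algebra_simps abs_minus_commute)
    ultimately show False
      using nondihedral by blast
  qed
  then have grow: "filterlim (\<lambda>n. norm (f (c + int n * a) (d + int n * b))) at_top sequentially"
    using neighbour_dichotomy[OF det l] by blast
  define M where "M = max 3 (norm (f a b))"
  have "\<forall>\<^sub>F n in sequentially. norm (f (c + int n * a) (d + int n * b)) \<ge> M"
    using grow unfolding filterlim_at_top by blast
  then obtain N where N: "\<And>n. n \<ge> N \<Longrightarrow> norm (f (c + int n * a) (d + int n * b)) \<ge> M"
    unfolding eventually_sequentially by blast
  have nz: "a \<noteq> 0 \<or> b \<noteq> 0"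
    using det by auto
  have "\<forall>\<^sub>F n in sequentially. slope_point (c + int n * a, d + int n * b) \<in> U"
    using slope_point_comb_tendsto[OF nz] U ab(2) by (rule topological_tendstoD)
  then obtain N' where N': "\<And>n. n \<ge> N' \<Longrightarrow> slope_point (c + int n * a, d + int n * b) \<in> U"
    unfolding eventually_sequentially by blast
  \<comment> \<open>\<open>Suc\<close> keeps \<open>n - 1\<close> at least \<open>N\<close>, so the
    terms before and after \<open>(p, q)\<close> in the sequence are large too.\<close>
  define n where "n = Suc (max N N')"
  define p q where "p = c + int n * a" and "q = d + int n * b"
  have large: "norm (f p q) \<ge> M" "norm (f (p + a) (q + b)) \<ge> M" "norm (f (p - a) (q - b)) \<ge> M"
    using N[of n] N[of "Suc n"] N[of "n - 1"] by (simp_all add: p_def q_def n_def algebra_simps)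
  have pqU: "slope_point (p, q) \<in> U"
    unfolding p_def q_def by (rule N') (simp add: n_def)
  have det': "\<bar>p * b - q * a\<bar> = 1"
    using det by (simp add: p_def q_def algebra_simps abs_minus_commute)
  then have cop: "coprime p q"
    by (rule coprime_of_det)
  have M: "M \<ge> 3" "norm (f a b) \<le> M"
    by (simp_all add: M_def)
  \<comment> \<open>These neighbours of \<open>(p, q)\<close> lie in the cone over
    \<open>(p, q)\<close> and \<open>(p + a, q + b)\<close>, behind whose edge lies
    \<open>(a, b)\<close>; on the left \<open>(p - a, q - b)\<close> plays the same part. So there
    is no decay on either side.\<close>
  have right: "norm (f (a + int k * p) (b + int k * q)) \<ge> 3" if "k > 0" for k
  proof -
    have "norm (f (int (k - 1) * p + int 1 * (p + a)) (int (k - 1) * q + int 1 * (q + b))) \<ge> M"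
    proof (rule cone_growth[OF _ _ M(1) large(1,2)])
      show "\<bar>p * (q + b) - q * (p + a)\<bar> = 1"
        using det' by (simp add: algebra_simps)
      show "norm (f (p - (p + a)) (q - (q + b))) \<le> max (norm (f p q)) (norm (f (p + a) (q + b)))"
        using minus[of a b] M large(1) by (simp add: le_max_iff_disj)
    qed simp
    then show ?thesis
      using that M(1) by (cases k) (simp_all add: algebra_simps)
  qed
  have left: "norm (f (- a + int k * p) (- b + int k * q)) \<ge> 3" if "k > 0" for k
  proof -
    have "norm (f (int (k - 1) * p + int 1 * (p - a)) (int (k - 1) * q + int 1 * (q - b))) \<ge> M"
    proof (rule cone_growth[OF _ _ M(1) large(1,3)])
      show "\<bar>p * (q - b) - q * (p - a)\<bar> = 1"
        using det' by (simp add: algebra_simps abs_minus_commute)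
      show "norm (f (p - (p - a)) (q - (q - b))) \<le> max (norm (f p q)) (norm (f (p - a) (q - b)))"
        using M large(1) by (simp add: le_max_iff_disj)
    qed simp
    then show ?thesis
      using that M(1) by (cases k) (simp_all add: algebra_simps)
  qed
  have "f p q \<notin> elliptic_range"
    using large(1) M(1) elliptic_range_norm_le[of "f p q"] by linarith
  then obtain l' where l': "norm l' > 1" "l' + inverse l' = f p q"
    by (rule exists_eigenvalue_norm_gt_1)
  from decaying_side[OF det' ends[OF cop pqU] l'] show False
  proof
    assume "\<forall>n. f (a + int n * p) (b + int n * q) = inverse l' ^ n * f a b"
    with l'(1) right show False
      by (rule not_decaying[where g = "\<lambda>n. f (a + int n * p) (b + int n * q)"])
  next
    assume "\<forall>n. f (- a + int n * p) (- b + int n * q) = inverse l' ^ n * f a b"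
    with l'(1) left show False
      by (rule not_decaying[where g = "\<lambda>n. f (- a + int n * p) (- b + int n * q)"])
  qed
qed

text \<open>From some index on, the neighbours of \<open>(a, b)\<close> have slopes in
  \<open>U\<close>. Their values are then real, bounded by 2, and obey the recurrence with
  coefficient \<open>x\<close>, to which \<open>recurrence_peak\<close> applies.\<close>

lemma real_values_on_open_set:
  assumes U: "open U" and ell: "\<And>a b. coprime a b \<Longrightarrow> slope_point (a, b) \<in> U \<Longrightarrow> f a b \<in> elliptic_range"
    and ab: "\<bar>a * d - b * c\<bar> = 1" "slope_point (a, b) \<in> U" "f a b = of_real x"
    and m: "vertex a b c d = of_real m" "m > 4"
  shows "\<exists>p q y. coprime p q \<and> slope_point (p, q) \<in> U \<and> f p q = of_real y \<and> y\<^sup>2 \<ge> m / 4 * x\<^sup>2"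
proof -
  have nz: "a \<noteq> 0 \<or> b \<noteq> 0"
    using ab(1) by auto
  have "\<forall>\<^sub>F n in sequentially. slope_point (c + int n * a, d + int n * b) \<in> U"
    using slope_point_comb_tendsto[OF nz] U ab(2) by (rule topological_tendstoD)
  then obtain N where N: "\<And>n. n \<ge> N \<Longrightarrow> slope_point (c + int n * a, d + int n * b) \<in> U"
    unfolding eventually_sequentially by blast
  define p q where "p n = c + int (N + n) * a" and "q n = d + int (N + n) * b" for n
  have pqU: "slope_point (p n, q n) \<in> U" for n
    unfolding p_def q_def by (rule N) simp
  have det: "\<bar>p n * b - q n * a\<bar> = 1" for n
    using ab(1) by (simp add: p_def q_def algebra_simps abs_minus_commute)
  have cop: "coprime (p n) (q n)" for n
    using det by (rule coprime_of_det)
  have Suc: "p (Suc n) = p n + a" "q (Suc n) = q n + b" for n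
    by (simp_all add: p_def q_def algebra_simps)
  have "\<exists>y. f (p n) (q n) = of_real y \<and> \<bar>y\<bar> \<le> 2" for n
    using ell[OF cop pqU] by (simp add: elliptic_range_iff)
  then obtain y where y: "\<And>n. f (p n) (q n) = of_real (y n)" "\<And>n. \<bar>y n\<bar> \<le> 2"
    by metis
  have x: "\<bar>x\<bar> \<le> 2"
    using ell[OF coprime_of_det(1)[OF ab(1)] ab(2)] unfolding ab(3) elliptic_range_iff by auto
  have rec: "y (Suc (Suc n)) = x * y (Suc n) - y n" for n
  proof -
    have "of_real (y (Suc (Suc n))) = f (p (Suc n) + a) (q (Suc n) + b)"
      by (simp add: y(1)[symmetric] Suc)
    also have "\<dots> = of_real (y (Suc n)) * f a b - of_real (y n)"
      using add_add_eq[OF det[of n]] by (simp add: Suc y(1)[symmetric])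
    also have "\<dots> = of_real (x * y (Suc n) - y n)"
      by (simp add: ab(3))
    finally show ?thesis
      by (simp only: of_real_eq_iff)
  qed
  have "f (p 0 + a) (q 0 + b) = of_real (y 1)"
    using y(1)[of 1] Suc[of 0] by simp
  then have "of_real (x\<^sup>2 + (y 0)\<^sup>2 + (y 1)\<^sup>2 - x * y 0 * y 1) = vertex (p 0) (q 0) a b"
    unfolding vertex_def y(1) ab(3) by (simp add: algebra_simps)
  also have "\<dots> = of_real m"
    using vertex_eq[OF det ab(1)] m(1) by simp
  finally have "x\<^sup>2 + (y 0)\<^sup>2 + (y 1)\<^sup>2 - x * y 0 * y 1 = m"
    by (simp only: of_real_eq_iff)
  from recurrence_peak[OF rec y(2) x this m(2)] obtain n where "(y n)\<^sup>2 \<ge> m / 4 * x\<^sup>2"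
    by blast
  then show ?thesis
    using cop pqU y(1) by blast
qed

text \<open>The squares of the values on \<open>U\<close> are bounded by 4, but for m > 4 a square
  close to their supremum could be enlarged by the factor m / 4 beyond it.\<close>

lemma vertex_le_4:
  assumes U: "open U" and ell: "\<And>a b. coprime a b \<Longrightarrow> slope_point (a, b) \<in> U \<Longrightarrow> f a b \<in> elliptic_range"
    and ab: "coprime a b" "slope_point (a, b) \<in> U" "f a b \<noteq> 0"
    and m: "\<And>a b c d. \<bar>a * d - b * c\<bar> = 1 \<Longrightarrow> vertex a b c d = of_real m"
  shows "m \<le> 4"
proof (rule ccontr)
  assume "\<not> m \<le> 4"
  define R where "R = {x\<^sup>2 | x a b. coprime a b \<and> slope_point (a, b) \<in> U \<and> f a b = complex_of_real x}"
  have "r \<le> 4" if rR: "r \<in> R" for r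
  proof -
    obtain x a b where x: "r = x\<^sup>2" "coprime a b" "slope_point (a, b) \<in> U" "f a b = complex_of_real x"
      using rR unfolding R_def by blast
    then have "\<bar>x\<bar> \<le> 2"
      using ell[OF x(2,3)] by (auto simp: elliptic_range_iff)
    then show ?thesis
      using abs_le_square_iff[of x 2] by (simp add: x(1))
  qed
  then have bdd: "bdd_above R"
    by (rule bdd_aboveI)
  obtain x where x: "f a b = of_real x"
    using ell[OF ab(1,2)] by (auto simp: elliptic_range_iff)
  have xR: "x\<^sup>2 \<in> R"
    unfolding R_def using x ab by blast
  have "x\<^sup>2 > 0"
    using ab(3) x by auto
  also have "x\<^sup>2 \<le> Sup R"
    using xR bdd by (rule cSup_upper)
  finally have S: "Sup R > 0" .
  \<comment> \<open>The threshold is the supremum divided by m / 4, so that one enlargement of any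
    square above it passes the supremum.\<close>
  have "Sup R * (4 / m) < Sup R * 1"
    using S \<open>\<not> m \<le> 4\<close> by (intro mult_strict_left_mono) auto
  then obtain r where r: "r \<in> R" "Sup R * (4 / m) < r"
    using less_cSup_iff[of R "Sup R * (4 / m)"] bdd xR by auto
  then obtain z p q where z: "r = z\<^sup>2" "coprime p q" "slope_point (p, q) \<in> U" "f p q = complex_of_real z"
    unfolding R_def by blast
  obtain c d where det: "\<bar>p * d - q * c\<bar> = 1"
    using coprime_extend[OF z(2)] .
  obtain p' q' y where "coprime p' q'" "slope_point (p', q') \<in> U" "f p' q' = complex_of_real y"
    and y: "y\<^sup>2 \<ge> m / 4 * z\<^sup>2"
    using real_values_on_open_set[OF U ell det z(3,4) m[OF det]] \<open>\<not> m \<le> 4\<close> by auto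
  then have "y\<^sup>2 \<in> R"
    unfolding R_def by blast
  then have "y\<^sup>2 \<le> Sup R"
    using bdd by (rule cSup_upper)
  moreover have "Sup R < m / 4 * r"
    using r(2) \<open>\<not> m \<le> 4\<close> by (simp add: field_simps)
  ultimately show False
    using y by (simp add: z(1))
qed

text \<open>A vector with slope in \<open>U\<close> and two consecutive far neighbours of it form a
  basis and its sum, all with slopes in \<open>U\<close>. The conclusions hold there, and
  \<open>elliptic_range_values\<close> carries them to the given basis.\<close>

lemma elliptic_everywhere:
  assumes U: "open U" "L \<in> U" "L \<in> PL" and ends: "U \<inter> PL \<subseteq> ends"
    and nondihedral: "\<And>a b c d. \<bar>a * d - b * c\<bar> = 1 \<Longrightarrow> f a b \<noteq> 0 \<or> f c d \<noteq> 0"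
    and det0: "\<bar>a0 * d0 - b0 * c0\<bar> = 1"
  obtains m where "f a0 b0 \<in> elliptic_range" "f c0 d0 \<in> elliptic_range"
    "f (a0 + c0) (b0 + d0) \<in> elliptic_range" "vertex a0 b0 c0 d0 = of_real m" "m \<le> 4"
proof -
  have "slope_point (a, b) \<in> ends" if "coprime a b" "slope_point (a, b) \<in> U" for a b
  proof -
    have "a \<noteq> 0 \<or> b \<noteq> 0"
      using that(1) by auto
    then show ?thesis
      using that(2) slope_point_in_PL ends by blast
  qed
  then have ell: "f a b \<in> elliptic_range" if "coprime a b" "slope_point (a, b) \<in> U" for a b
    using elliptic_on_open_set_of_ends[OF U(1) _ nondihedral] that by blast
  obtain p q where pq: "coprime p q" "slope_point (p, q) \<in> U"
    using slope_points_dense[OF U(3,1,2)] .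
  obtain c d where cd: "\<bar>p * d - q * c\<bar> = 1"
    using coprime_extend[OF pq(1)] .
  have nz: "p \<noteq> 0 \<or> q \<noteq> 0"
    using cd by auto
  have "\<forall>\<^sub>F n in sequentially. slope_point (c + int n * p, d + int n * q) \<in> U"
    using slope_point_comb_tendsto[OF nz] U(1) pq(2) by (rule topological_tendstoD)
  then obtain n where n: "\<And>k. k \<ge> n \<Longrightarrow> slope_point (c + int k * p, d + int k * q) \<in> U"
    unfolding eventually_sequentially by blast
  define r s where "r = c + int n * p" and "s = d + int n * q"
  have rsU: "slope_point (r, s) \<in> U" "slope_point (p + r, q + s) \<in> U"
    using n[of n] n[of "Suc n"] by (simp_all add: r_def s_def algebra_simps)
  have det: "\<bar>p * s - q * r\<bar> = 1"
    using cd by (simp add: r_def s_def algebra_simps)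
  then have "\<bar>p * (q + s) - q * (p + r)\<bar> = 1"
    by (simp add: algebra_simps)
  then have cop: "coprime r s" "coprime (p + r) (q + s)"
    using coprime_of_det(2) det by blast+
  have e: "f p q \<in> elliptic_range" "f r s \<in> elliptic_range" "f (p + r) (q + s) \<in> elliptic_range"
    using ell pq rsU cop by blast+
  then obtain x y z where xyz: "f p q = of_real x" "f r s = of_real y" "f (p + r) (q + s) = of_real z"
    unfolding elliptic_range_iff by blast
  define m where "m = x\<^sup>2 + y\<^sup>2 + z\<^sup>2 - x * y * z"
  have "vertex p q r s = of_real m"
    by (simp add: vertex_def xyz m_def)
  then have v: "vertex a b c d = of_real m" if "\<bar>a * d - b * c\<bar> = 1" for a b c d
    using vertex_eq[OF that det] by simp
  \<comment> \<open>\<open>vertex_le_4\<close> asks for a nonzero value on \<open>U\<close>; one of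
    the two basis vectors provides it.\<close>
  have "m \<le> 4"
    using nondihedral[OF det] vertex_le_4[OF U(1) ell pq _ v] vertex_le_4[OF U(1) ell cop(1) rsU(1) _ v]
    by blast
  then show thesis
    using that v[OF det0] elliptic_range_values[OF det0 det e v[OF det]] by blast
qed

text \<open>Under a global bound any sequence of distinct curves is admissible, so it suffices that
  every \<open>L\<close> is a limit point of slope points. A second slope close to a given one comes
  from a far neighbour.\<close>

lemma ends_eq_PL_if_bounded:
  assumes "\<And>a b. coprime a b \<Longrightarrow> norm (f a b) \<le> K"
  shows "ends = PL"
proof
  show "ends \<subseteq> PL"
    by (auto simp: ends_def)
  show "PL \<subseteq> ends"
  proof
    fix L assume L: "L \<in> PL"
    have "L islimpt (slope_point ` curves)"
    proof (rule islimptI)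
      fix T assume T: "L \<in> T" "open T"
      obtain a b where ab: "coprime a b" "slope_point (a, b) \<in> T"
        using slope_points_dense[OF L T(2,1)] .
      obtain c d where det: "\<bar>a * d - b * c\<bar> = 1"
        using coprime_extend[OF ab(1)] .
      have nz: "a \<noteq> 0 \<or> b \<noteq> 0"
        using det by auto
      have "\<forall>\<^sub>F n in sequentially. slope_point (c + int n * a, d + int n * b) \<in> T"
        using slope_point_comb_tendsto[OF nz] T(2) ab(2) by (rule topological_tendstoD)
      then obtain n where n: "slope_point (c + int n * a, d + int n * b) \<in> T"
        using eventually_happens'[OF sequentially_bot] by blast
      define p q where "p = c + int n * a" and "q = d + int n * b"
      have det': "\<bar>p * b - q * a\<bar> = 1"
        using det by (simp add: p_def q_def algebra_simps abs_minus_commute)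
      then have pq: "coprime p q" "p \<noteq> 0 \<or> q \<noteq> 0"
        using coprime_of_det(1)[OF det'] by auto
      have "dist (slope_point (p, q)) (slope_point (a, b)) > 0"
        unfolding dist_slope_point[OF pq(2) nz] of_int_abs[symmetric] det' using pq(2) nz by auto
      then have ne: "slope_point (p, q) \<noteq> slope_point (a, b)"
        by auto
      have mem: "slope_point (x, y) \<in> slope_point ` curves" if "coprime x y" for x y
        using curves_coprime[OF that] by (metis imageI slope_point_minus)
      \<comment> \<open>Of two different slope points in \<open>T\<close>, at least one is not
        \<open>L\<close>.\<close>
      show "\<exists>y\<in>slope_point ` curves. y \<in> T \<and> y \<noteq> L"
        using mem[OF ab(1)] mem[OF pq(1)] ab(2) n ne unfolding p_def q_def by metis
    qed
    then obtain g where g: "\<And>n. g n \<in> slope_point ` curves - {L}" "inj g" "g \<longlonglongrightarrow> L"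
      using islimpt_imp_inj_sequence by blast
    have "\<exists>c. c \<in> curves \<and> slope_point c = g n" for n
      using g(1)[of n] by (metis DiffE imageE)
    then obtain Xs where Xs: "\<And>n. Xs n \<in> curves" "\<And>n. slope_point (Xs n) = g n"
      by metis
    have "inj Xs"
      using g(2) Xs(2) by (metis injD injI)
    moreover have "norm (f (fst (Xs n)) (snd (Xs n))) < \<bar>K\<bar> + 1" for n
      using assms[of "fst (Xs n)" "snd (Xs n)"] Xs(1)[of n] by (auto simp: curves_def)
    moreover have "(\<lambda>n. slope_point (Xs n)) \<longlonglongrightarrow> L"
      using g(3) Xs(2) by simp
    moreover have "\<bar>K\<bar> + 1 > 0" by simp
    ultimately show "L \<in> ends"
      unfolding ends_def using L Xs(1) by blast
  qed
qed

end

subsection \<open>Characters of SU(2) representations\<close>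

text \<open>The conjugate transpose is the inverse, and for determinant one the inverse is the
  adjugate; compare entries.\<close>

lemma SU2_form:
  assumes "A \<in> SU2"
  shows "A$2$2 = cnj (A$1$1)" "A$2$1 = - cnj (A$1$2)" "A$1$1 * cnj (A$1$1) + A$1$2 * cnj (A$1$2) = 1"
proof -
  have det: "A$1$1 * A$2$2 - A$1$2 * A$2$1 = 1"
    using assms by (simp add: SU2_def det_2)
  have "(A ** conj_transpose A) $ i $ j = mat 1 $ i $ j" for i j
    using assms by (simp add: SU2_def)
  then have m: "(\<Sum>k\<in>UNIV. A$i$k * cnj (A$j$k)) = (if i = j then 1 else 0)" for i j
    by (simp add: matrix_matrix_mult_def conj_transpose_def mat_def)
  have m11: "A$1$1 * cnj (A$1$1) + A$1$2 * cnj (A$1$2) = 1"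
    and m21: "A$2$1 * cnj (A$1$1) + A$2$2 * cnj (A$1$2) = 0"
    using m[of 1 1] m[of 2 1] by (simp_all add: sum_2)
  have "cnj (A$1$1) = cnj (A$1$1) * (A$1$1 * A$2$2 - A$1$2 * A$2$1)"
    by (simp add: det)
  also have "\<dots> = A$2$2 * (A$1$1 * cnj (A$1$1) + A$1$2 * cnj (A$1$2)) -
      A$1$2 * (A$2$1 * cnj (A$1$1) + A$2$2 * cnj (A$1$2))"
    by (simp add: algebra_simps)
  finally show "A$2$2 = cnj (A$1$1)"
    by (simp add: m11 m21)
  have "cnj (A$1$2) = cnj (A$1$2) * (A$1$1 * A$2$2 - A$1$2 * A$2$1)"
    by (simp add: det)
  also have "\<dots> = A$1$1 * (A$2$1 * cnj (A$1$1) + A$2$2 * cnj (A$1$2)) -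
      A$2$1 * (A$1$1 * cnj (A$1$1) + A$1$2 * cnj (A$1$2))"
    by (simp add: algebra_simps)
  finally show "A$2$1 = - cnj (A$1$2)"
    by (simp add: m11 m21)
  show "A$1$1 * cnj (A$1$1) + A$1$2 * cnj (A$1$2) = 1"
    by (rule m11)
qed

text \<open>Unit quaternions: with \<open>u\<close>, \<open>v\<close> the imaginary parts of \<open>A\<close>, \<open>B\<close>, the bound is the Cauchy-Schwarz
  inequality \<open>(u \<bullet> v)\<^sup>2 \<le> \<bar>u\<bar>\<^sup>2 \<bar>v\<bar>\<^sup>2\<close>.\<close>

lemma SU2_character_real:
  assumes "SU2_character (x, y, z)"
  obtains r s t where "x = of_real r" "y = of_real s" "z = of_real t"
    "\<bar>r\<bar> \<le> 2" "\<bar>s\<bar> \<le> 2" "\<bar>t\<bar> \<le> 2" "r\<^sup>2 + s\<^sup>2 + t\<^sup>2 - r * s * t \<le> 4"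
proof -
  obtain A B where A: "A \<in> SU2" and B: "B \<in> SU2" and c: "character A B = (x, y, z)"
    using assms by (auto simp: SU2_character_def)
  note fA = SU2_form[OF A] and fB = SU2_form[OF B]
  define a1 a2 a3 a4 where "a1 = Re (A$1$1)" and "a2 = Im (A$1$1)" and "a3 = Re (A$1$2)" and "a4 = Im (A$1$2)"
  define b1 b2 b3 b4 where "b1 = Re (B$1$1)" and "b2 = Im (B$1$1)" and "b3 = Re (B$1$2)" and "b4 = Im (B$1$2)"
  define w where "w = a2 * b2 + a3 * b3 + a4 * b4"
  have na: "a2\<^sup>2 + a3\<^sup>2 + a4\<^sup>2 = 1 - a1\<^sup>2" and nb: "b2\<^sup>2 + b3\<^sup>2 + b4\<^sup>2 = 1 - b1\<^sup>2"
    using arg_cong[OF fA(3), of Re] arg_cong[OF fB(3), of Re]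
    by (simp_all add: a1_def a2_def a3_def a4_def b1_def b2_def b3_def b4_def power2_eq_square)
  have x: "x = of_real (2 * a1)" and y: "y = of_real (2 * b1)"
    using c fA(1) fB(1)
    by (auto simp: character_def trace_def sum_2 a1_def b1_def complex_eq_iff)
  have z: "z = of_real (2 * (a1 * b1 - w))"
    using c fA(1,2) fB(1,2)
    by (auto simp: character_def trace_def sum_2 matrix_matrix_mult_def complex_eq_iff w_def
      a1_def a2_def a3_def a4_def b1_def b2_def b3_def b4_def)
  have cs: "w\<^sup>2 \<le> (1 - a1\<^sup>2) * (1 - b1\<^sup>2)"
  proof -
    have "(1 - a1\<^sup>2) * (1 - b1\<^sup>2) - w\<^sup>2 =
        (a2 * b3 - a3 * b2)\<^sup>2 + (a2 * b4 - a4 * b2)\<^sup>2 + (a3 * b4 - a4 * b3)\<^sup>2"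
      unfolding na[symmetric] nb[symmetric] w_def by (simp add: power2_eq_square algebra_simps)
    also have "\<dots> \<ge> 0" by simp
    finally show ?thesis by simp
  qed
  have a: "a1\<^sup>2 \<le> 1"
    using na zero_le_power2[of a2] zero_le_power2[of a3] zero_le_power2[of a4] by linarith
  have b: "b1\<^sup>2 \<le> 1"
    using nb zero_le_power2[of b2] zero_le_power2[of b3] zero_le_power2[of b4] by linarith
  have r: "\<bar>2 * a1\<bar> \<le> 2" "\<bar>2 * b1\<bar> \<le> 2"
    using abs_square_le_1[of a1] abs_square_le_1[of b1] a b by simp_all
  \<comment> \<open>\<open>s = 1\<close> belongs to the pair of \<open>A\<close> and
    \<open>B\<close>, \<open>s = -1\<close> to that of \<open>A\<close> and the inverse of
    \<open>B\<close>; flipping the latter bounds the trace of \<open>A ** B\<close>.\<close>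
  have vertex: "(2 * a1)\<^sup>2 + (2 * b1)\<^sup>2 + (2 * (a1 * b1 - s * w))\<^sup>2 - (2 * a1) * (2 * b1) * (2 * (a1 * b1 - s * w)) \<le> 4"
    if "s\<^sup>2 = 1" for s
  proof -
    have "(2 * a1)\<^sup>2 + (2 * b1)\<^sup>2 + (2 * (a1 * b1 - s * w))\<^sup>2 - (2 * a1) * (2 * b1) * (2 * (a1 * b1 - s * w)) =
        4 + 4 * (s\<^sup>2 * w\<^sup>2 - (1 - a1\<^sup>2) * (1 - b1\<^sup>2))"
      by (simp add: power2_eq_square algebra_simps)
    then show ?thesis
      using cs that by simp
  qed
  have "\<bar>(2 * a1) * (2 * b1) - 2 * (a1 * b1 - -1 * w)\<bar> \<le> 2"
    by (rule abs_flip_le_2[OF r vertex]) simp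
  then have "\<bar>2 * (a1 * b1 - w)\<bar> \<le> 2"
    by (simp add: algebra_simps)
  then show thesis
    using that[OF x y z r] vertex[of 1] by simp
qed

lemma SU2_matrix:
  assumes "u * cnj u + v * cnj v = 1"
  shows "vector [vector [u, v], vector [- cnj v, cnj u]] \<in> SU2"
  using assms
  by (simp add: SU2_def det_2 conj_transpose_def matrix_matrix_mult_def mat_def vec_eq_iff forall_2 sum_2 algebra_simps)

text \<open>\<open>A\<close> is taken diagonal with first entry x/2 + i s, and \<open>B\<close> with
  first entry y/2 + i k. The trace of the product is then x y / 2 - 2 s k, which dictates
  \<open>k\<close>, and the hypothesis \<open>m\<close> leaves room for a real
  \<open>t\<close>.\<close>

lemma SU2_character_exists:
  fixes x y z :: real
  assumes le: "\<bar>x\<bar> \<le> 2" "\<bar>y\<bar> \<le> 2" and m: "x\<^sup>2 + y\<^sup>2 + z\<^sup>2 - x * y * z \<le> 4"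
  shows "SU2_character (of_real x, of_real y, of_real z)"
proof -
  define s where "s = sqrt (1 - x\<^sup>2 / 4)"
  define k where "k = (if s = 0 then 0 else (x * y / 2 - z) / (2 * s))"
  define t where "t = sqrt (1 - y\<^sup>2 / 4 - k\<^sup>2)"
  have x4: "x\<^sup>2 \<le> 4" and y4: "y\<^sup>2 \<le> 4"
    using abs_le_square_iff[of x 2] abs_le_square_iff[of y 2] le by simp_all
  have s2: "s\<^sup>2 = 1 - x\<^sup>2 / 4"
    using x4 by (simp add: s_def)
  have sq: "(x * y / 2 - z)\<^sup>2 \<le> 4 * s\<^sup>2 * (1 - y\<^sup>2 / 4)"
  proof -
    have "4 * s\<^sup>2 * (1 - y\<^sup>2 / 4) - (x * y / 2 - z)\<^sup>2 = 4 - (x\<^sup>2 + y\<^sup>2 + z\<^sup>2 - x * y * z)"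
      unfolding s2 by (simp add: power2_eq_square field_simps)
    then show ?thesis
      using m by linarith
  qed
  \<comment> \<open>If \<open>s = 0\<close>, then \<open>sq\<close> forces z = x y / 2, so the
    default value \<open>k = 0\<close> is right.\<close>
  have sk: "2 * s * k = x * y / 2 - z"
    using sq by (auto simp: k_def)
  have "k\<^sup>2 \<le> 1 - y\<^sup>2 / 4"
  proof (cases "s = 0")
    case True
    then show ?thesis using y4 by (simp add: k_def)
  next
    case False
    have "4 * s\<^sup>2 * k\<^sup>2 = (2 * s * k)\<^sup>2"
      by (simp add: power_mult_distrib)
    also have "\<dots> \<le> 4 * s\<^sup>2 * (1 - y\<^sup>2 / 4)"
      unfolding sk by (rule sq)
    finally show ?thesis
      using False by (simp add: mult_le_cancel_left_pos)
  qed
  then have t2: "t\<^sup>2 = 1 - y\<^sup>2 / 4 - k\<^sup>2"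
    by (simp add: t_def)
  define u p where "u = Complex (x / 2) s" and "p = Complex (y / 2) k"
  define A B :: "complex^2^2" where "A = vector [vector [u, 0], vector [- cnj 0, cnj u]]"
    and "B = vector [vector [p, of_real t], vector [- cnj (of_real t), cnj p]]"
  have "A \<in> SU2"
    unfolding A_def
    by (rule SU2_matrix) (use s2 in \<open>simp add: u_def complex_eq_iff power2_eq_square field_simps\<close>)
  moreover have "B \<in> SU2"
    unfolding B_def
    by (rule SU2_matrix) (use t2 in \<open>simp add: p_def complex_eq_iff power2_eq_square field_simps\<close>)
  moreover have "character A B = (of_real x, of_real y, of_real z)"
    using sk by (simp add: character_def trace_def sum_2 matrix_matrix_mult_def A_def B_def u_def p_def
        complex_eq_iff field_simps)
  ultimately show ?thesis
    unfolding SU2_character_def by blast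
qed

section \<open>Markoff maps whose set of ends is everything or has an interior point\<close>

context markoff_map
begin

lemma ends_eq_PL_if_dihedral:
  assumes "dihedral (f 0 1, f 1 0, f 1 1)"
  shows "ends = PL"
proof -
  \<comment> \<open>Two summands vanish, so the sum is the remaining value.\<close>
  define t where "t = f 0 1 + f 1 0 + f 1 1"
  have "f 0 1 \<in> {0, t, - t}" "f 1 0 \<in> {0, t, - t}" "f (0 + 1) (1 + 0) \<in> {0, t, - t}"
    "dihedral (f 0 1, f 1 0, f (0 + 1) (1 + 0))"
    using assms by (auto simp: dihedral_def t_def)
  then have "f a b \<in> {0, t, - t}" if "\<bar>a * d - b * c\<bar> = 1" for a b c d
    using dihedral_values[OF that, of 0 0 1 1 t] by simp
  then have "norm (f a b) \<le> norm t" if "coprime a b" for a b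
    using coprime_extend[OF that] by (metis insertE norm_ge_zero norm_minus_cancel norm_zero order_refl singletonD)
  then show ?thesis
    by (rule ends_eq_PL_if_bounded)
qed

lemma ends_eq_PL_if_SU2_character:
  assumes "SU2_character (f 0 1, f 1 0, f 1 1)"
  shows "ends = PL"
proof -
  obtain r s t where rst: "f 0 1 = of_real r" "f 1 0 = of_real s" "f 1 1 = of_real t"
    "\<bar>r\<bar> \<le> 2" "\<bar>s\<bar> \<le> 2" "\<bar>t\<bar> \<le> 2" and m: "r\<^sup>2 + s\<^sup>2 + t\<^sup>2 - r * s * t \<le> 4"
    using SU2_character_real[OF assms] .
  have ell: "f 0 1 \<in> elliptic_range" "f 1 0 \<in> elliptic_range" "f (0 + 1) (1 + 0) \<in> elliptic_range"
    using rst by (auto simp: elliptic_range_iff)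
  have v: "vertex 0 1 1 0 = of_real (r\<^sup>2 + s\<^sup>2 + t\<^sup>2 - r * s * t)"
    by (simp add: vertex_def rst)
  have "norm (f a b) \<le> 2" if cop: "coprime a b" for a b
  proof -
    obtain c d where "\<bar>a * d - b * c\<bar> = 1"
      using coprime_extend[OF cop] .
    from elliptic_range_values[OF this _ ell v m] show ?thesis
      using elliptic_range_norm_le by simp
  qed
  then show ?thesis
    by (rule ends_eq_PL_if_bounded)
qed

text \<open>If some basis carries two zeros, \<open>dihedral_values\<close> brings this back to the
  standard basis. Otherwise \<open>elliptic_everywhere\<close> yields a real triple that
  \<open>SU2_character_exists\<close> realises.\<close>

lemma dihedral_or_SU2_if_interior:
  assumes U: "open U" "L \<in> U" "L \<in> PL" "U \<inter> PL \<subseteq> ends"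
  shows "dihedral (f 0 1, f 1 0, f 1 1) \<or> SU2_character (f 0 1, f 1 0, f 1 1)"
proof (cases "\<forall>a b c d. \<bar>a * d - b * c\<bar> = 1 \<longrightarrow> f a b \<noteq> 0 \<or> f c d \<noteq> 0")
  case True
  obtain m where ell: "f 0 1 \<in> elliptic_range" "f 1 0 \<in> elliptic_range" "f 1 1 \<in> elliptic_range"
    and m: "vertex 0 1 1 0 = of_real m" "m \<le> 4"
    by (rule elliptic_everywhere[OF U, of 0 0 1 1]) (use True in auto)
  then obtain x y z where xyz: "f 0 1 = of_real x" "f 1 0 = of_real y" "f 1 1 = of_real z"
    and le: "\<bar>x\<bar> \<le> 2" "\<bar>y\<bar> \<le> 2"
    unfolding elliptic_range_iff by blast
  have "of_real (x\<^sup>2 + y\<^sup>2 + z\<^sup>2 - x * y * z) = (of_real m :: complex)"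
    using m(1) by (simp add: vertex_def xyz)
  then have "x\<^sup>2 + y\<^sup>2 + z\<^sup>2 - x * y * z \<le> 4"
    using m(2) by (simp only: of_real_eq_iff)
  then show ?thesis
    unfolding xyz using SU2_character_exists[OF le] by blast
next
  case False
  then obtain a b c d where det: "\<bar>a * d - b * c\<bar> = 1" and "f a b = 0" "f c d = 0"
    by blast
  then have "dihedral (f a b, f c d, f (a + c) (b + d))"
    "f a b \<in> {0, t, - t}" "f c d \<in> {0, t, - t}" if "t = f (a + c) (b + d)" for t
    by (simp_all add: dihedral_def)
  then show ?thesis
    using dihedral_values[of 0 0 1 1, OF _ det, of "f (a + c) (b + d)"] by simp
qed

end

theorem theorem1p1:
  fixes A B :: "complex^2^2"
  assumes "A \<in> SL2C" and "B \<in> SL2C"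
  shows "(end_invariants A B = PL \<longleftrightarrow>
            dihedral (character A B) \<or> SU2_character (character A B))
       \<and> (end_invariants A B \<noteq> PL \<longrightarrow>
            (top_of_set PL) interior_of (end_invariants A B) = {})"
proof -
  define f where "f = fold_trace A B LY LYi"
  interpret markoff_map f
    unfolding f_def by (rule markoff_map_fold_trace[OF assms])
  have eq: "curve_trace A B c = f (fst c) (snd c)" if "c \<in> curves" for c
    using curve_trace_eq_fold_trace[OF assms, of "fst c" "snd c"] that by (simp add: f_def)
  have ends: "end_invariants A B = ends"
    unfolding end_invariants_def ends_def by (simp add: eq cong: conj_cong)
  have char: "character A B = (f 0 1, f 1 0, f 1 1)"
    by (simp add: f_def fold_trace_def character_def)
      (simp add: cone_trace_def christoffel_def word_mat_def letter_mat_def)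
  \<comment> \<open>A single interior point serves both claims: it exists when
    \<open>ends = PL\<close>, and it already forces one of the two cases.\<close>
  have if_interior: "dihedral (character A B) \<or> SU2_character (character A B)"
    if L: "L \<in> (top_of_set PL) interior_of ends" for L
  proof -
    obtain V where V: "openin (top_of_set PL) V" "L \<in> V" "V \<subseteq> ends"
      using L unfolding interior_of_def by blast
    from V(1) obtain U where "open U" "V = PL \<inter> U"
      unfolding openin_open by blast
    with V have "open U" "L \<in> U" "L \<in> PL" "U \<inter> PL \<subseteq> ends"
      by auto
    then show ?thesis
      unfolding char by (rule dihedral_or_SU2_if_interior)
  qed
  have if_char: "ends = PL" if "dihedral (character A B) \<or> SU2_character (character A B)"
    using that ends_eq_PL_if_dihedral ends_eq_PL_if_SU2_character unfolding char by blast
  have "1 \<in> (top_of_set PL) interior_of PL"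
    using interior_of_topspace[of "top_of_set PL"] by (simp add: PL_def)
  then have "(top_of_set PL) interior_of ends \<noteq> {}" if "ends = PL"
    unfolding that by (rule ex_in_conv[THEN iffD1, OF exI])
  then show ?thesis
    unfolding ends using if_char if_interior by (cases "ends = PL") fast+
qed

end
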